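(* For $p\in[1,\infty]$ there is a one-sided adaptive $(\epsilon,\ell_p)$-tester for real symmetric $d\times d$ matrices that makes $O\!\left(\frac{1}{\epsilon}d^{1-1/p}\log^3\!\left(\frac{1}{\epsilon}d^{1-1/p}\right)\right)$ vector-matrix-vector queries.
   Context: For a real symmetric $d\times d$ matrix $A$, $\|A\|_p$ denotes the Schatten-$p$ norm (the $\ell_p$ norm of the vector of singular values; $\|A\|_\infty$ is the operator norm), and $\lambda_{\min}(A)$ is its smallest eigenvalue. PSD means positive semidefinite. The parameter $\epsilon$ satisfies $0<\epsilon<1$, and $1/p=0$ when $p=\infty$. In the vector-matrix-vector model an algorithm accesses an unknown real symmetric $d\times d$ matrix $A$ through queries in which it chooses a pair of vectors $(v,w)$ in $\mathbb{R}^d$ and receives $v^TAw$; it is adaptive if queries may depend on the answers to previous queries. For $p\in[1,\infty]$, an $(\epsilon,\ell_p)$-tester is a (randomized) algorithm that makes such queries to $A$, outputs True with probability at least $2/3$ if $A$ is PSD, and outputs False with probability at least $2/3$ if $A$ is $\epsilon\|A\|_p$-far in spectral distance from the PSD cone, or equivalently if $\lambda_{\min}(A)\le-\epsilon\|A\|_p$. The tester is one-sided (has one-sided error) if it is guaranteed to output True on all PSD inputs, even if the input is generated by an adversary with access to the random coins of the tester. $O(\cdot)$ is the standard asymptotic notation.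
   Formalization: The zero matrix is exempt from the requirement to output False: it is PSD and also satisfies λ_min(A) ≤ −ε‖A‖_p (0 ≤ 0), so read literally a tester would have to output both True and False on it with probability at least 2/3. *)

theory Defs
  imports
    "HOL-Probability.Probability"
    "HOL-Library.Landau_Symbols"
    "Jordan_Normal_Form.Spectral_Radius"
begin

(* Matrices and vectors are those of Jordan_Normal_Form (dimension as a value), so that the
   dimension d can be quantified inside formulas; several names are also used by HOL-Analysis
   and are therefore qualified by "Matrix". *)

definition sym_mats :: "nat \<Rightarrow> real Matrix.mat set" where
  "sym_mats d = {A \<in> carrier_mat d d. transpose_mat A = A}"

definition psd :: "real Matrix.mat \<Rightarrow> bool" where
  "psd A \<longleftrightarrow> (\<forall>x \<in> carrier_vec (dim_row A). scalar_prod x (A *\<^sub>v x) \<ge> 0)"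

(* Meaningful for symmetric matrices of positive dimension, whose spectrum is finite and nonempty. *)
definition lambda_min :: "real Matrix.mat \<Rightarrow> real" where
  "lambda_min A = Min (spectrum A)"

(* proots is the multiset of roots, so singular values are counted with multiplicity. *)
definition singular_values :: "real Matrix.mat \<Rightarrow> real multiset" where
  "singular_values A = image_mset sqrt (proots (char_poly (transpose_mat A * A)))"

definition schatten_norm :: "ereal \<Rightarrow> real Matrix.mat \<Rightarrow> real" where
  "schatten_norm p A =
     (if p = \<infinity> then Max (set_mset (singular_values A))
      else (\<Sum>s\<in>#singular_values A. s powr real_of_ereal p) powr (1 / real_of_ereal p))"

(* The zero matrix is positive semidefinite and also satisfies the inequality below (as 0 \<le> 0),
   so without A \<noteq> 0 no algorithm at all could meet both requirements on a tester. *)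
definition far_from_psd :: "real \<Rightarrow> ereal \<Rightarrow> real Matrix.mat \<Rightarrow> bool" where
  "far_from_psd \<epsilon> p A \<longleftrightarrow>
     A \<noteq> 0\<^sub>m (dim_row A) (dim_col A) \<and> lambda_min A \<le> - \<epsilon> * schatten_norm p A"

(* A deterministic adaptive algorithm in the vector-matrix-vector model is a decision tree:
   Query v w k asks for the value of v^T A w and continues with k applied to the answer. *)
datatype vmv_alg =
    Output bool
  | Query "real Matrix.vec" "real Matrix.vec" "real \<Rightarrow> vmv_alg"

primrec run :: "real Matrix.mat \<Rightarrow> vmv_alg \<Rightarrow> bool" where
  "run A (Output b) = b"
| "run A (Query v w k) = run A (k (scalar_prod v (A *\<^sub>v w)))"

primrec num_queries :: "real Matrix.mat \<Rightarrow> vmv_alg \<Rightarrow> nat" where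
  "num_queries A (Output b) = 0"
| "num_queries A (Query v w k) = Suc (num_queries A (k (scalar_prod v (A *\<^sub>v w))))"

primrec queries_in_dim :: "nat \<Rightarrow> vmv_alg \<Rightarrow> bool" where
  "queries_in_dim d (Output b) = True"
| "queries_in_dim d (Query v w k) =
     (v \<in> carrier_vec d \<and> w \<in> carrier_vec d \<and> (\<forall>r. queries_in_dim d (k r)))"

(* A randomized algorithm is a probability space M of coin outcomes together with a deterministic
   algorithm T \<omega> for each outcome \<omega>.  The output has to be jointly measurable in the coins and the
   entries of the input: measurability in \<omega> for each fixed input would not suffice, since under
   choice it admits families (T \<omega>) that succeed with probability 1 on every fixed input although
   each T \<omega> is tailored to a set of fewer than continuum many inputs.  Joint measurability implies
   that the events in psd_tester are measurable. *)
definition rand_vmv_alg :: "nat \<Rightarrow> 'c measure \<Rightarrow> ('c \<Rightarrow> vmv_alg) \<Rightarrow> bool" where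
  "rand_vmv_alg d M T \<longleftrightarrow>
     prob_space M \<and>
     (\<forall>\<omega> \<in> space M. queries_in_dim d (T \<omega>)) \<and>
     (\<lambda>(\<omega>, a). run (Matrix.mat d d a) (T \<omega>))
       \<in> measurable (M \<Otimes>\<^sub>M (\<Pi>\<^sub>M ij \<in> {..<d} \<times> {..<d}. borel)) (count_space UNIV)"

definition psd_tester ::
    "real \<Rightarrow> ereal \<Rightarrow> nat \<Rightarrow> 'c measure \<Rightarrow> ('c \<Rightarrow> vmv_alg) \<Rightarrow> bool" where
  "psd_tester \<epsilon> p d M T \<longleftrightarrow>
     rand_vmv_alg d M T \<and>
     (\<forall>A \<in> sym_mats d. psd A \<longrightarrow> measure M {\<omega> \<in> space M. run A (T \<omega>)} \<ge> 2 / 3) \<and>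
     (\<forall>A \<in> sym_mats d. far_from_psd \<epsilon> p A \<longrightarrow>
        measure M {\<omega> \<in> space M. \<not> run A (T \<omega>)} \<ge> 2 / 3)"

(* The input may depend on the coins, hence no exceptional null set. *)
definition one_sided :: "nat \<Rightarrow> 'c measure \<Rightarrow> ('c \<Rightarrow> vmv_alg) \<Rightarrow> bool" where
  "one_sided d M T \<longleftrightarrow> (\<forall>\<omega> \<in> space M. \<forall>A \<in> sym_mats d. psd A \<longrightarrow> run A (T \<omega>))"

definition makes_at_most :: "nat \<Rightarrow> 'c measure \<Rightarrow> ('c \<Rightarrow> vmv_alg) \<Rightarrow> nat \<Rightarrow> bool" where
  "makes_at_most d M T n \<longleftrightarrow> (\<forall>\<omega> \<in> space M. \<forall>A \<in> sym_mats d. num_queries A (T \<omega>) \<le> n)"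

end

theory Submission
  imports Defs "HOL-Real_Asymp.Real_Asymp"
begin

text \<open>
  By the power mean inequality the Schatten norms reduce to the sum \<open>t\<close> of the absolute values of the
  eigenvalues: with \<open>X = d powr (1 - 1/p) / \<epsilon>\<close>, a matrix far from PSD has an eigenvalue \<open>- l\<close> with
  \<open>t \<le> X l\<close>.

  A vector of negative energy is sought by stochastic descent for \<open>q x = x \<bullet> A x\<close>: in a random sign
  direction \<open>g\<close> query \<open>a = g \<bullet> A x\<close> and \<open>b = g \<bullet> A g\<close>, reject if \<open>q x < 0\<close> or \<open>a\<^sup>2 > q x b\<close> (impossible
  for PSD matrices by Cauchy-Schwarz, whence one-sidedness), and move to \<open>x - \<eta> a g\<close>.  For \<open>\<eta>\<close> a small
  multiple of \<open>1 / t\<close> the energy decreases on average by at least \<open>\<eta> \<parallel>A x\<parallel>\<^sup>2\<close>, while the component of \<open>x\<close>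
  along the negative eigenvector grows by the factor \<open>1 + \<eta> l\<close> per step up to a noise of variance at most
  \<open>3 \<eta>\<^sup>2 \<parallel>A x\<parallel>\<^sup>2\<close>.  The total noise is therefore controlled by the initial energy, and after
  \<open>O(X log X)\<close> steps \<open>\<parallel>A x\<parallel>\<^sup>2\<close> is so large compared with \<open>q x\<close> that rejection has constant probability.
  As \<open>t\<close> is not known, \<open>O(log X)\<close> dyadic values of \<open>\<eta>\<close> are tried, calibrated by the first answer \<open>a\<close>;
  a constant number of repetitions boosts the probability to \<open>2/3\<close>.
\<close>

unbundle no inner_syntax
unbundle no vec_syntax
hide_const (open) Finite_Cartesian_Product.vec Finite_Cartesian_Product.mat
  Finite_Cartesian_Product.row Finite_Cartesian_Product.transpose

subsection \<open>Symmetric matrices\<close>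

lemma symmetric_scalar_prod:
  fixes A :: "'a :: comm_semiring_0 mat"
  assumes "A \<in> carrier_mat n n" "transpose_mat A = A" "x \<in> carrier_vec n" "y \<in> carrier_vec n"
  shows "x \<bullet> (A *\<^sub>v y) = y \<bullet> (A *\<^sub>v x)"
proof -
  have "x \<bullet> (A *\<^sub>v y) = (A *\<^sub>v x) \<bullet> y"
    using transpose_vec_mult_scalar[OF assms(1,4,3)] assms(2) by simp
  also have "\<dots> = y \<bullet> (A *\<^sub>v x)"
    by (rule comm_scalar_prod[of _ n]) (use assms in auto)
  finally show ?thesis .
qed

lemma scalar_prod_self_nonneg: "(v :: real vec) \<bullet> v \<ge> 0"
  by (simp add: scalar_prod_def sum_nonneg)

text \<open>Moving the matrix across the product of an eigenvector with its conjugate evaluates the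
  same number as \<open>c\<close> and as \<open>cnj c\<close> times the nonzero squared
  length.\<close>

lemma eigenvalue_of_real_symmetric_is_real:
  fixes A :: "real mat"
  assumes A: "A \<in> carrier_mat n n" "transpose_mat A = A"
    and ev: "eigenvalue (map_mat complex_of_real A) c"
  shows "c \<in> \<real>"
proof -
  let ?A = "map_mat complex_of_real A"
  have CA: "?A \<in> carrier_mat n n" "transpose_mat ?A = ?A"
    using A map_mat_transpose[of complex_of_real A] by auto
  obtain v where v: "v \<in> carrier_vec n" "v \<noteq> 0\<^sub>v n" "?A *\<^sub>v v = c \<cdot>\<^sub>v v"
    using ev CA unfolding eigenvalue_def eigenvector_def by auto
  have cv: "conjugate v \<in> carrier_vec n" using v by simp
  have Acv: "?A *\<^sub>v conjugate v = conjugate (?A *\<^sub>v v)"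
    using A(1) v(1) by (intro eq_vecI) (auto simp: scalar_prod_def sum_conjugate intro!: sum.cong)
  have "c * (v \<bullet> conjugate v) = (?A *\<^sub>v v) \<bullet> conjugate v"
    using v cv by (simp add: smult_scalar_prod_distrib[of _ n])
  also have "\<dots> = conjugate v \<bullet> (?A *\<^sub>v v)"
    by (rule comm_scalar_prod[of _ n]) (use CA v cv in auto)
  also have "\<dots> = v \<bullet> (?A *\<^sub>v conjugate v)"
    by (rule symmetric_scalar_prod[OF CA cv v(1)])
  also have "\<dots> = cnj c * (v \<bullet> conjugate v)"
    using v cv unfolding Acv v(3) by (simp add: conjugate_smult_vec scalar_prod_smult_distrib[of _ n])
  finally have "c = cnj c"
    using v by (simp add: conjugate_square_eq_0_vec[of _ n])
  then show ?thesis by (metis Reals_cnj_iff)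
qed

text \<open>The polynomial splits over the complex numbers, its roots are real, and the injective
  embedding of real polynomials pulls the factorization back.\<close>

lemma char_poly_real_symmetric_splits:
  fixes A :: "real mat"
  assumes A: "A \<in> carrier_mat n n" "transpose_mat A = A"
  shows "\<exists>es. char_poly A = (\<Prod>e\<leftarrow>es. [:- e, 1:]) \<and> length es = n"
proof -
  let ?A = "map_mat complex_of_real A"
  have CA: "?A \<in> carrier_mat n n" using A by auto
  obtain as where as: "char_poly ?A = (\<Prod>a\<leftarrow>as. [:- a, 1:])" "length as = n"
    using char_poly_factorized[OF CA] by blast
  have "a \<in> \<real>" if "a \<in> set as" for a
  proof (rule eigenvalue_of_real_symmetric_is_real[OF A])
    show "eigenvalue ?A a"
      unfolding eigenvalue_root_char_poly[OF CA] as(1) using that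
      by (auto simp: poly_prod_list prod_list_zero_iff)
  qed
  then have "map (\<lambda>a. complex_of_real (Re a)) as = as"
    by (intro map_idI) auto
  then have asR: "map complex_of_real (map Re as) = as" by (simp add: o_def)
  interpret p: map_poly_inj_idom_hom complex_of_real ..
  have "map_poly complex_of_real (\<Prod>e\<leftarrow>bs. [:- e, 1:]) = (\<Prod>a\<leftarrow>map complex_of_real bs. [:- a, 1:])" for bs
    by (induction bs) (simp_all add: p.hom_mult map_poly_pCons del: mult_pCons_left)
  from this[of "map Re as"] have "map_poly complex_of_real (char_poly A) =
      map_poly complex_of_real (\<Prod>e\<leftarrow>map Re as. [:- e, 1:])"
    unfolding asR of_real_hom.char_poly_hom[OF A(1), symmetric] as(1) by simp
  then have "char_poly A = (\<Prod>e\<leftarrow>map Re as. [:- e, 1:])"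
    by simp
  then show ?thesis using as(2) by (intro exI[of _ "map Re as"]) simp
qed


section \<open>Singular values of a symmetric matrix\<close>

lemma mult_upper_triangular:
  fixes A B :: "'a :: comm_semiring_0 mat"
  assumes A: "A \<in> carrier_mat n n" "upper_triangular A" and B: "B \<in> carrier_mat n n" "upper_triangular B"
  shows "upper_triangular (A * B)" "i < n \<Longrightarrow> (A * B) $$ (i, i) = A $$ (i, i) * B $$ (i, i)"
proof -
  have z: "A $$ (i, k) * B $$ (k, j) = 0" if "i < n" "j < n" "k < n" "j < k \<or> k < i" for i j k
    using that A B by (auto simp: upper_triangular_def)
  show "upper_triangular (A * B)"
    unfolding upper_triangular_def
  proof (intro allI impI)
    fix i j assume ij: "i < dim_row (A * B)" "j < i"
    have "(A * B) $$ (i, j) = (\<Sum>k = 0..<n. A $$ (i, k) * B $$ (k, j))"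
      using ij A B by (simp add: scalar_prod_def)
    also have "\<dots> = 0"
      by (intro sum.neutral ballI z) (use ij A B in auto)
    finally show "(A * B) $$ (i, j) = 0" .
  qed
  assume i: "i < n"
  have "(A * B) $$ (i, i) = (\<Sum>k = 0..<n. A $$ (i, k) * B $$ (k, i))"
    using i A B by (simp add: scalar_prod_def)
  also have "\<dots> = (\<Sum>k\<in>{i}. A $$ (i, k) * B $$ (k, i))"
    by (intro sum.mono_neutral_right ballI z) (use i in auto)
  finally show "(A * B) $$ (i, i) = A $$ (i, i) * B $$ (i, i)" by simp
qed

text \<open>By Schur triangularization \<open>A\<close> is similar to an upper triangular matrix
  with diagonal \<open>es\<close>, and squaring that matrix squares its diagonal. For symmetric
  \<open>A\<close> the roots obtained are the squared singular values.\<close>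

lemma char_poly_square:
  fixes A :: "'a :: conjugatable_ordered_field mat"
  assumes A: "A \<in> carrier_mat n n" and es: "char_poly A = (\<Prod>e\<leftarrow>es. [:- e, 1:])"
  shows "char_poly (A * A) = (\<Prod>e\<leftarrow>es. [:- (e * e), 1:])"
proof -
  obtain B P Q where "schur_decomposition A es = (B, P, Q)"
    by (cases "schur_decomposition A es") auto
  from schur_decomposition[OF A es this]
  have wit: "similar_mat_wit A B P Q" and B: "upper_triangular B" "diag_mat B = es" by auto
  note w = similar_mat_witD2[OF A wit]
  have sq: "C * C = C ^\<^sub>m 2" if "C \<in> carrier_mat n n" for C :: "'a mat"
    using that by (simp add: numeral_2_eq_2)
  have "similar_mat (A * A) (B * B)"
    using similar_mat_wit_pow[OF wit, of 2] sq A w unfolding similar_mat_def by metis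
  then have "char_poly (A * A) = char_poly (B * B)" by (rule char_poly_similar)
  also have "\<dots> = (\<Prod>a\<leftarrow>diag_mat (B * B). [:- a, 1:])"
    by (rule char_poly_upper_triangular[of _ n]) (use w B in \<open>auto intro: mult_upper_triangular\<close>)
  also have "diag_mat (B * B) = map (\<lambda>e. e * e) es"
    unfolding B(2)[symmetric] using w B(1)
    by (auto simp: diag_mat_def mult_upper_triangular(2)[of B n B] simp del: index_mult_mat(1))
  finally show ?thesis by (simp add: o_def)
qed

lemma singular_values_symmetric:
  assumes A: "A \<in> carrier_mat n n" "transpose_mat A = A"
    and es: "char_poly A = (\<Prod>e\<leftarrow>es. [:- e, 1:])"
  shows "singular_values A = image_mset abs (mset es)"
proof -
  have "proots (\<Prod>e\<leftarrow>as. [:- e, 1:]) = mset as" for as :: "real list"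
  proof (induction as)
    case (Cons a as)
    have "(\<Prod>e\<leftarrow>as. [:- e, 1:]) \<noteq> 0" by (auto simp: prod_list_zero_iff)
    then show ?case using Cons by (simp add: proots_mult del: mult_pCons_left)
  qed simp
  from this[of "map (\<lambda>e. e * e) es"] show ?thesis
    unfolding singular_values_def A(2) char_poly_square[OF A(1) es]
    by (simp add: o_def multiset.map_comp)
qed


section \<open>Orthogonal diagonalization of the quadratic form\<close>

lemma orthonormal_basis_extending:
  fixes v :: "real vec"
  assumes v: "v \<in> carrier_vec n" "v \<noteq> 0\<^sub>v n"
  obtains W c where "W \<in> carrier_mat n n" "transpose_mat W * W = 1\<^sub>m n"
    "W * transpose_mat W = 1\<^sub>m n" "n > 0" "col W 0 = c \<cdot>\<^sub>v v"
proof -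
  interpret cof_vec_space n "TYPE(real)" .
  define b where "b = basis_completion v"
  define ws where "ws = gram_schmidt n b"
  note b = basis_completion[OF v, folded b_def]
  from v have n: "n > 0" by (intro gr0I) auto
  from b(6,7) n obtain vs where bv: "b = v # vs" by (cases b) auto
  note gs = gram_schmidt_result[OF b(2,4,5) refl, folded ws_def]
  have len: "length ws = n" using gs(4) b(6) by simp
  \<comment> \<open>Gram-Schmidt leaves the first vector of its input unchanged, so the first
    normalized column is a multiple of \<open>v\<close>.\<close>
  have hd: "ws ! 0 = v"
    using gram_schmidt_hd[OF v(1), of vs, folded bv ws_def] len n by (cases ws) auto
  define W where "W = mat_of_cols n (map (\<lambda>w. (1 / sqrt (w \<bullet> w)) \<cdot>\<^sub>v w) ws)"
  have W: "W \<in> carrier_mat n n" unfolding W_def using len by auto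
  have ws: "ws ! i \<in> carrier_vec n" if "i < n" for i using gs(3) len that by auto
  have colW: "col W i = (1 / sqrt (ws ! i \<bullet> ws ! i)) \<cdot>\<^sub>v ws ! i" if "i < n" for i
    unfolding W_def using that len ws by (subst col_mat_of_cols) auto
  have orth: "ws ! i \<bullet> ws ! j = 0 \<longleftrightarrow> i \<noteq> j" if "i < n" "j < n" for i j
    using corthogonalD[OF gs(2)] that len by simp
  have pos: "ws ! i \<bullet> ws ! i > 0" if "i < n" for i
    using orth[OF that that] scalar_prod_self_nonneg[of "ws ! i"] by linarith
  have WW: "transpose_mat W * W = 1\<^sub>m n"
  proof (rule eq_matI)
    fix i j assume ij: "i < dim_row (1\<^sub>m n)" "j < dim_col (1\<^sub>m n)"
    then have "(transpose_mat W * W) $$ (i, j) = col W i \<bullet> col W j" using W by simp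
    also have "\<dots> = (1 / sqrt (ws ! i \<bullet> ws ! i)) * (1 / sqrt (ws ! j \<bullet> ws ! j)) * (ws ! i \<bullet> ws ! j)"
      using ij ws by (simp add: colW smult_scalar_prod_distrib[of _ n] scalar_prod_smult_distrib[of _ n])
    also have "\<dots> = 1\<^sub>m n $$ (i, j)"
      using ij orth[of i j] pos[of i] by (cases "i = j") (simp_all add: field_simps)
    finally show "(transpose_mat W * W) $$ (i, j) = 1\<^sub>m n $$ (i, j)" .
  qed (use W in auto)
  show thesis
  proof (rule that[OF W WW _ n])
    show "W * transpose_mat W = 1\<^sub>m n"
      by (rule mat_mult_left_right_inverse[OF _ W WW]) (use W in auto)
    show "col W 0 = (1 / sqrt (v \<bullet> v)) \<cdot>\<^sub>v v" using colW[OF n] hd by simp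
  qed
qed

text \<open>The spectral theorem by deflation: in an orthonormal basis that starts with an
  eigenvector for \<open>e\<close>, symmetry makes the matrix block diagonal with blocks
  \<open>e\<close> and \<open>C\<close>, and the characteristic polynomial of \<open>C\<close> keeps
  the remaining roots.\<close>

lemma real_symmetric_quadratic_form:
  fixes A :: "real mat"
  assumes "A \<in> carrier_mat n n" "transpose_mat A = A"
    and "char_poly A = (\<Prod>e\<leftarrow>es. [:- e, 1:])"
  shows "\<exists>vs. length vs = length es \<and> (\<forall>v\<in>set vs. v \<in> carrier_vec n \<and> v \<bullet> v = 1) \<and>
    (\<forall>g\<in>carrier_vec n. g \<bullet> (A *\<^sub>v g) = (\<Sum>(e, v)\<leftarrow>zip es vs. e * (g \<bullet> v)\<^sup>2))"
  using assms
proof (induction es arbitrary: n A)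
  case Nil
  then have "n = 0" using degree_monic_char_poly[of A n] by simp
  then show ?case using Nil by (auto simp: scalar_prod_def)
next
  case (Cons e es)
  note A = Cons.prems(1,2)
  have "eigenvalue A e"
    unfolding eigenvalue_root_char_poly[OF A(1)] Cons.prems(3) by simp
  then obtain v where v: "v \<in> carrier_vec n" "v \<noteq> 0\<^sub>v n" "A *\<^sub>v v = e \<cdot>\<^sub>v v"
    using A unfolding eigenvalue_def eigenvector_def by auto
  obtain W c where W: "W \<in> carrier_mat n n" "transpose_mat W * W = 1\<^sub>m n"
    "W * transpose_mat W = 1\<^sub>m n" and n: "n > 0" and W0: "col W 0 = c \<cdot>\<^sub>v v"
    by (rule orthonormal_basis_extending[OF v(1,2)])
  obtain k where k: "n = Suc k" using n by (cases n) auto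
  let ?W = "transpose_mat W"
  have W': "?W \<in> carrier_mat n n" using W by simp
  define B where "B = ?W * A * W"
  have B: "B \<in> carrier_mat n n" unfolding B_def using W A by auto
  have AB: "A = W * B * ?W"
  proof -
    have "W * B * ?W = (W * ?W) * A * (W * ?W)"
      unfolding B_def using W(1) W' A(1)
      by (simp add: assoc_mult_mat[of _ n n _ n _ n] mult_carrier_mat[of _ n n _ n])
    then show ?thesis using W A by simp
  qed
  have Bsym: "transpose_mat B = B"
    unfolding B_def using W(1) W' A by (simp add: transpose_mult[of _ n n _ n])
  have Bidx: "B $$ (i, j) = col W i \<bullet> (A *\<^sub>v col W j)" if "i < n" "j < n" for i j
  proof -
    have "B = ?W * (A * W)" unfolding B_def using W(1) W' A(1) by simp
    then show ?thesis using that W(1) A(1) by (simp add: mult_mat_vec_def)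
  qed
  have B0: "B $$ (i, 0) = (if i = 0 then e else 0)" if "i < n" for i
  proof -
    have "col W i \<bullet> col W 0 = (?W * W) $$ (i, 0)" using that n W(1) by simp
    then have "col W i \<bullet> col W 0 = (if i = 0 then 1 else 0)" using that n W by simp
    moreover have "A *\<^sub>v col W 0 = e \<cdot>\<^sub>v col W 0"
      unfolding W0 using A v by (simp add: mult_mat_vec smult_smult_assoc mult.commute)
    ultimately show ?thesis
      using Bidx[OF that n] that n W(1) by (simp add: scalar_prod_smult_distrib[of _ n])
  qed
  have B0': "B $$ (0, j) = (if j = 0 then e else 0)" if "j < n" for j
    using B0[OF that] B that n arg_cong[OF Bsym, of "\<lambda>M. M $$ (0, j)"] by simp
  define C where "C = mat k k (\<lambda>(i, j). B $$ (Suc i, Suc j))"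
  have C: "C \<in> carrier_mat k k" unfolding C_def by simp
  have Csym: "transpose_mat C = C"
  proof -
    have "B $$ (j, i) = B $$ (i, j)" if "i < n" "j < n" for i j
      using that B arg_cong[OF Bsym, of "\<lambda>M. M $$ (i, j)"] by simp
    then show ?thesis by (intro eq_matI) (auto simp: C_def k)
  qed
  have blk: "B = four_block_mat (mat 1 1 (\<lambda>_. e)) (0\<^sub>m 1 k) (0\<^sub>m k 1) C"
    using B B0 B0' by (intro eq_matI) (auto simp: C_def k)
  have "similar_mat A B"
    unfolding similar_mat_def using similar_mat_witI[OF W(3,2) AB A(1) B W(1) W'] by blast
  then have "[:- e, 1:] * (\<Prod>e\<leftarrow>es. [:- e, 1:]) = char_poly B"
    using Cons.prems(3) by (simp add: char_poly_similar)
  also have "\<dots> = char_poly (mat 1 1 (\<lambda>_. e)) * char_poly C"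
    unfolding blk by (rule char_poly_four_block_zeros_col) (use C in auto)
  also have "char_poly (mat 1 1 (\<lambda>_. e)) = [:- e, 1:]"
    by (simp add: char_poly_defs det_def sign_def)
  finally have "char_poly C = (\<Prod>e\<leftarrow>es. [:- e, 1:])"
    by (metis mult_cancel_left pCons_eq_0_iff zero_neq_one)
  from Cons.IH[OF C Csym this] obtain vs where vs: "length vs = length es"
    "\<And>v. v \<in> set vs \<Longrightarrow> v \<in> carrier_vec k \<and> v \<bullet> v = 1"
    "\<And>g. g \<in> carrier_vec k \<Longrightarrow> g \<bullet> (C *\<^sub>v g) = (\<Sum>(e, v)\<leftarrow>zip es vs. e * (g \<bullet> v)\<^sup>2)"
    by blast
  \<comment> \<open>In the rotated coordinates the eigenvectors are the first unit vector and the
    zero-padded ones of \<open>C\<close>; the isometry \<open>W\<close> carries them back.\<close>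
  define us where "us = map (\<lambda>u. W *\<^sub>v u) (vCons 1 (0\<^sub>v k) # map (vCons 0) vs)"
  have isom: "(W *\<^sub>v x) \<bullet> (W *\<^sub>v y) = x \<bullet> y" if "x \<in> carrier_vec n" "y \<in> carrier_vec n" for x y
    using transpose_vec_mult_scalar[OF W' _ that(1), of "W *\<^sub>v y"] that W W'
    by (simp flip: assoc_mult_mat_vec[of _ n n _ n])
  have us: "u \<in> carrier_vec n \<and> u \<bullet> u = 1" if "u \<in> set us" for u
    using that W(1) vs(2) by (auto simp: us_def isom k zero_vec_Suc[symmetric])
  have form: "g \<bullet> (A *\<^sub>v g) = (\<Sum>(e, v)\<leftarrow>zip (e # es) us. e * (g \<bullet> v)\<^sup>2)" if g: "g \<in> carrier_vec n" for g
  proof -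
    have "?W *\<^sub>v g \<in> carrier_vec (Suc k)" using g W' by (simp add: k)
    then obtain a h where ah: "?W *\<^sub>v g = vCons a h" "h \<in> carrier_vec k"
      by (metis vCons_carrier_vec vec_cases carrier_vecD dim_vec nat.distinct(1))
    have gu: "g \<bullet> (W *\<^sub>v u) = vCons a h \<bullet> u" if "u \<in> carrier_vec n" for u
      using transpose_vec_mult_scalar[OF W(1) that g] ah by simp
    have "B *\<^sub>v vCons a h = vCons (e * a) (C *\<^sub>v h)"
    proof (rule eq_vecI)
      fix i assume i: "i < dim_vec (vCons (e * a) (C *\<^sub>v h))"
      have row: "row B i = (if i = 0 then vCons e (0\<^sub>v k) else vCons 0 (row C (i - 1)))"
        using i C B B0 B0' by (intro eq_vecI) (auto simp: k C_def vec_index_vCons)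
      show "(B *\<^sub>v vCons a h) $ i = vCons (e * a) (C *\<^sub>v h) $ i"
        using i C B ah(2) by (auto simp: row k vec_index_vCons)
    qed (use B C k in auto)
    moreover have "A *\<^sub>v g = W *\<^sub>v (B *\<^sub>v (?W *\<^sub>v g))"
      using W(1) W' B g
      by (subst AB) (simp add: assoc_mult_mat_vec[of _ n n _ n] mult_carrier_mat[of _ n n _ n])
    ultimately have "g \<bullet> (A *\<^sub>v g) = vCons a h \<bullet> vCons (e * a) (C *\<^sub>v h)"
      using gu[of "B *\<^sub>v (?W *\<^sub>v g)"] mult_mat_vec_carrier[OF B mult_mat_vec_carrier[OF W' g]] ah(1)
      by simp
    also have "\<dots> = e * a\<^sup>2 + (\<Sum>(e, v)\<leftarrow>zip es vs. e * (h \<bullet> v)\<^sup>2)"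
      using vs(3)[OF ah(2)] by (simp add: power2_eq_square)
    also have "(\<Sum>(e, v)\<leftarrow>zip es vs. e * (h \<bullet> v)\<^sup>2) =
        (\<Sum>(e, v)\<leftarrow>zip es (map (\<lambda>u. W *\<^sub>v vCons 0 u) vs). e * (g \<bullet> v)\<^sup>2)"
      using vs(2) by (simp add: zip_map2 o_def)
        (intro arg_cong[of _ _ sum_list] map_cong, auto simp: gu k dest!: set_zip_rightD)
    finally show ?thesis
      using ah(2) by (simp add: us_def gu k o_def power2_eq_square)
  qed
  show ?case
    by (rule exI[of _ us]) (use us form vs(1) in \<open>auto simp: us_def\<close>)
qed

section \<open>Comparison of Schatten norms\<close>

text \<open>Jensen's inequality for the power \<open>r\<close> with equal weights on the support
  \<open>J\<close> of \<open>f\<close>; replacing \<open>card J\<close> by \<open>card I\<close> is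
  monotone because \<open>1 - 1 / r\<close> is nonnegative.\<close>

lemma sum_le_card_powr_sum_powr:
  fixes f :: "'a \<Rightarrow> real"
  assumes I: "finite I" and f: "\<And>i. i \<in> I \<Longrightarrow> f i \<ge> 0" and r: "r \<ge> 1"
  shows "(\<Sum>i\<in>I. f i) \<le> real (card I) powr (1 - 1 / r) * (\<Sum>i\<in>I. f i powr r) powr (1 / r)"
proof (cases "\<forall>i\<in>I. f i = 0")
  case True
  then show ?thesis by simp
next
  case False
  define J where "J = {i \<in> I. f i \<noteq> 0}"
  define k where "k = real (card J)"
  have J: "finite J" "J \<noteq> {}" "\<And>i. i \<in> J \<Longrightarrow> f i > 0"
    using False I f by (auto simp: J_def less_le)
  have k: "k > 0" unfolding k_def using J by (simp add: card_gt_0_iff)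
  have sums: "(\<Sum>i\<in>I. f i) = (\<Sum>i\<in>J. f i)" "(\<Sum>i\<in>I. f i powr r) = (\<Sum>i\<in>J. f i powr r)"
    unfolding J_def using I by (auto intro!: sum.mono_neutral_right)
  define S where "S = (\<Sum>i\<in>J. f i powr r)"
  have S: "S \<ge> 0" unfolding S_def by (simp add: sum_nonneg)
  have m: "(1 / k) * (\<Sum>i\<in>J. f i) \<ge> 0"
    using k J(3) by (intro mult_nonneg_nonneg sum_nonneg) (auto intro: less_imp_le)
  have "(\<Sum>i\<in>J. (1 / k) *\<^sub>R f i) powr r \<le> (\<Sum>i\<in>J. (1 / k) * f i powr r)"
    by (rule convex_on_sum[OF J(1,2) powr_convex[OF r]]) (use k J in \<open>auto simp: k_def\<close>)
  then have "((1 / k) * (\<Sum>i\<in>J. f i)) powr r \<le> (1 / k) * S"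
    by (simp add: S_def sum_distrib_left sum_divide_distrib)
  then have "(((1 / k) * (\<Sum>i\<in>J. f i)) powr r) powr (1 / r) \<le> ((1 / k) * S) powr (1 / r)"
    using r by (intro powr_mono2) auto
  moreover have "(((1 / k) * (\<Sum>i\<in>J. f i)) powr r) powr (1 / r) = (1 / k) * (\<Sum>i\<in>J. f i)"
    using r m by (simp add: powr_powr del: times_divide_eq_left)
  ultimately have "(1 / k) * (\<Sum>i\<in>J. f i) \<le> (1 / k) powr (1 / r) * S powr (1 / r)"
    using k S powr_mult[of "1 / k" S "1 / r"] by simp
  then have "k * ((1 / k) * (\<Sum>i\<in>J. f i)) \<le> k * ((1 / k) powr (1 / r) * S powr (1 / r))"
    using k by (intro mult_left_mono) auto
  moreover have "k * ((1 / k) powr (1 / r)) = k powr (1 - 1 / r)"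
    using k by (simp add: powr_diff powr_divide)
  ultimately have "(\<Sum>i\<in>J. f i) \<le> k powr (1 - 1 / r) * S powr (1 / r)"
    using k by (simp add: mult.assoc[symmetric])
  also have "\<dots> \<le> real (card I) powr (1 - 1 / r) * S powr (1 / r)"
    using k r I by (intro mult_right_mono powr_mono2) (auto simp: k_def J_def intro!: card_mono)
  finally show ?thesis unfolding sums S_def .
qed

text \<open>The singular values are the absolute eigenvalues. For finite \<open>p\<close> the power
  mean inequality applies; for infinite \<open>p\<close> each summand is at most the maximum and the
  exponent of \<open>d\<close> is 1.\<close>

lemma sum_abs_le_schatten_norm:
  fixes A :: "real mat"
  assumes A: "A \<in> carrier_mat d d" "transpose_mat A = A"
    and es: "char_poly A = (\<Prod>e\<leftarrow>es. [:- e, 1:])" "length es = d"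
    and d: "d \<ge> 1" and p: "1 \<le> p"
  shows "(\<Sum>e\<leftarrow>es. \<bar>e\<bar>) \<le> real d powr (1 - real_of_ereal (1 / p)) * schatten_norm p A"
proof (cases p)
  case PInf
  have "\<bar>e\<bar> \<le> schatten_norm p A" if "e \<in> set es" for e
    unfolding schatten_norm_def singular_values_symmetric[OF A es(1)] using that PInf
    by (auto intro: Max_ge)
  then have "(\<Sum>e\<leftarrow>es. \<bar>e\<bar>) \<le> (\<Sum>e\<leftarrow>es. schatten_norm p A)"
    by (intro sum_list_mono)
  then show ?thesis using PInf d es(2) by (simp add: sum_list_const_mult sum_list_triv)
next
  case (real r)
  then have r: "r \<ge> 1" using p by simp
  define S where "S = (\<Sum>i<d. \<bar>es ! i\<bar> powr r)"
  have "schatten_norm p A = (\<Sum>e\<leftarrow>es. \<bar>e\<bar> powr r) powr (1 / r)"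
    unfolding schatten_norm_def singular_values_symmetric[OF A es(1)] using real
    by (simp add: multiset.map_comp o_def sum_mset_sum_list flip: mset_map)
  then have norm: "schatten_norm p A = S powr (1 / r)"
    unfolding S_def using es(2) by (simp add: sum_list_sum_nth atLeast0LessThan)
  have "(\<Sum>i<d. \<bar>es ! i\<bar>) \<le> real d powr (1 - 1 / r) * S powr (1 / r)"
    unfolding S_def using sum_le_card_powr_sum_powr[of "{..<d}" "\<lambda>i. \<bar>es ! i\<bar>" r] r by simp
  then have "(\<Sum>i<d. \<bar>es ! i\<bar>) \<le> real d powr (1 - 1 / r) * schatten_norm p A"
    unfolding norm .
  moreover have "real_of_ereal (1 / p) = 1 / r" using real r by (simp add: one_ereal_def)
  ultimately show ?thesis
    using es(2) by (simp add: sum_list_sum_nth atLeast0LessThan one_ereal_def)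
qed (use p in simp)

text \<open>The vectors in \<open>ws\<close> are the eigenvectors of the positive eigenvalues, scaled so that the sum
  of the rank-one forms is the positive part of the quadratic form.\<close>

lemma far_from_psd_witness:
  fixes A :: "real mat"
  assumes A: "A \<in> sym_mats d" and d: "d \<ge> 1" and p: "1 \<le> p" and \<epsilon>: "0 < \<epsilon>"
    and far: "far_from_psd \<epsilon> p A"
  obtains v :: "real vec" and l and ws :: "real vec list" and t where
    "v \<in> carrier_vec d" "v \<bullet> v = 1" "A *\<^sub>v v = (- l) \<cdot>\<^sub>v v" "0 < t"
    "t \<le> 1 / \<epsilon> * real d powr (1 - real_of_ereal (1 / p)) * l"
    "\<And>w. w \<in> set ws \<Longrightarrow> w \<in> carrier_vec d" "(\<Sum>w\<leftarrow>ws. w \<bullet> w) \<le> t"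
    "\<And>g. g \<in> carrier_vec d \<Longrightarrow> g \<bullet> (A *\<^sub>v g) \<le> (\<Sum>w\<leftarrow>ws. (g \<bullet> w)\<^sup>2)"
proof -
  have A: "A \<in> carrier_mat d d" "transpose_mat A = A" using A by (auto simp: sym_mats_def)
  obtain es where es: "char_poly A = (\<Prod>e\<leftarrow>es. [:- e, 1:])" "length es = d"
    using char_poly_real_symmetric_splits[OF A] by blast
  obtain vs where vs: "length vs = d" "\<And>v. v \<in> set vs \<Longrightarrow> v \<in> carrier_vec d \<and> v \<bullet> v = 1"
    "\<And>g. g \<in> carrier_vec d \<Longrightarrow> g \<bullet> (A *\<^sub>v g) = (\<Sum>(e, v)\<leftarrow>zip es vs. e * (g \<bullet> v)\<^sup>2)"
    using real_symmetric_quadratic_form[OF A es(1)] es(2) by auto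
  define t where "t = (\<Sum>e\<leftarrow>es. \<bar>e\<bar>)"
  define l where "l = - lambda_min A"
  define ws where "ws = map (\<lambda>(e, v). sqrt (max e 0) \<cdot>\<^sub>v v) (zip es vs)"
  have ne: "spectrum A \<noteq> {}"
  proof -
    obtain e where "e \<in> set es" using es(2) d by (cases es) auto
    then have "poly (char_poly A) e = 0" unfolding es(1) by (auto simp: poly_prod_list prod_list_zero_iff)
    then show ?thesis using eigenvalue_root_char_poly[OF A(1)] by (auto simp: spectrum_def)
  qed
  have "lambda_min A \<in> spectrum A"
    unfolding lambda_min_def by (rule Min_in[OF card_finite_spectrum(1)[OF A(1)] ne])
  then obtain u where u: "u \<in> carrier_vec d" "u \<noteq> 0\<^sub>v d" "A *\<^sub>v u = (- l) \<cdot>\<^sub>v u"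
    using A unfolding spectrum_def eigenvalue_def eigenvector_def l_def by auto
  have uu: "u \<bullet> u > 0"
    using u scalar_prod_self_nonneg[of u] conjugate_square_eq_0_vec[of u d] by (simp add: less_le)
  define v where "v = (1 / sqrt (u \<bullet> u)) \<cdot>\<^sub>v u"
  show thesis
  proof (rule that)
    show "v \<in> carrier_vec d" using u by (simp add: v_def)
    show "v \<bullet> v = 1" using u uu
      by (simp add: v_def smult_scalar_prod_distrib[of _ d] scalar_prod_smult_distrib[of _ d] field_simps)
    show "A *\<^sub>v v = (- l) \<cdot>\<^sub>v v"
      using A u by (simp add: v_def mult_mat_vec smult_smult_assoc mult.commute)
    \<comment> \<open>If all eigenvalues vanished, so would the form; polarization with unit vectors
      then kills every entry, against the exclusion of the zero matrix in
      \<open>far_from_psd\<close>.\<close>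
    show "0 < t"
    proof (rule ccontr)
      assume "\<not> 0 < t"
      moreover have "t \<ge> 0" unfolding t_def by (intro sum_list_nonneg) auto
      ultimately have "t = 0" by simp
      then have "\<forall>e\<in>set es. e = 0"
        unfolding t_def by (subst (asm) sum_list_nonneg_eq_0_iff) auto
      then have *: "g \<bullet> (A *\<^sub>v g) = 0" if "g \<in> carrier_vec d" for g
      proof -
        have "(\<Sum>(e, v)\<leftarrow>zip es vs. e * (g \<bullet> v)\<^sup>2) = (\<Sum>_\<leftarrow>zip es vs. 0)"
          by (intro arg_cong[of _ _ sum_list] map_cong) (auto dest!: set_zip_leftD simp: \<open>\<forall>e\<in>set es. e = 0\<close>)
        then show ?thesis using vs(3)[OF that] by simp
      qed
      have "A $$ (i, j) = 0" if ij: "i < d" "j < d" for i j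
      proof -
        have e: "unit_vec d i \<bullet> (A *\<^sub>v unit_vec d j) = A $$ (i, j)" if "i < d" "j < d" for i j
          using that A by simp
        have "0 = (unit_vec d i + unit_vec d j) \<bullet> (A *\<^sub>v (unit_vec d i + unit_vec d j))"
          by (subst *) auto
        also have "\<dots> = A $$ (i, i) + A $$ (i, j) + A $$ (j, i) + A $$ (j, j)"
          using A ij by (simp add: mult_add_distrib_mat_vec[of _ d d] add_scalar_prod_distrib[of _ d]
            scalar_prod_add_distrib[of _ d] del: scalar_prod_left_unit)
            (simp add: e del: scalar_prod_left_unit)
        also have "A $$ (j, i) = A $$ (i, j)"
          using ij A(1) arg_cong[OF A(2), of "\<lambda>M. M $$ (i, j)"] by simp
        also have "A $$ (i, i) = 0" using *[of "unit_vec d i"] e[of i i] ij by simp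
        also have "A $$ (j, j) = 0" using *[of "unit_vec d j"] e[of j j] ij by simp
        finally show ?thesis by simp
      qed
      then have "A = 0\<^sub>m d d" using A by (intro eq_matI) auto
      then show False using far A by (simp add: far_from_psd_def)
    qed
    have "\<epsilon> * schatten_norm p A \<le> l" using far by (simp add: far_from_psd_def l_def)
    then have "schatten_norm p A \<le> l / \<epsilon>" using \<epsilon> by (simp add: field_simps)
    have "t \<le> real d powr (1 - real_of_ereal (1 / p)) * schatten_norm p A"
      unfolding t_def by (rule sum_abs_le_schatten_norm[OF A es d p])
    also have "\<dots> \<le> real d powr (1 - real_of_ereal (1 / p)) * (l / \<epsilon>)"
      by (intro mult_left_mono) (use \<open>schatten_norm p A \<le> l / \<epsilon>\<close> in auto)
    finally show "t \<le> 1 / \<epsilon> * real d powr (1 - real_of_ereal (1 / p)) * l" by simp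
    show "w \<in> carrier_vec d" if "w \<in> set ws" for w
      using that vs(2) by (auto simp: ws_def dest!: set_zip_rightD)
    have "(\<Sum>w\<leftarrow>ws. w \<bullet> w) = (\<Sum>(e, v)\<leftarrow>zip es vs. max e 0)"
      unfolding ws_def map_map
      by (intro arg_cong[of _ _ sum_list] map_cong)
         (auto dest!: set_zip_rightD vs(2) simp: smult_scalar_prod_distrib[of _ d] scalar_prod_smult_distrib[of _ d])
    also have "\<dots> = (\<Sum>e\<leftarrow>map fst (zip es vs). max e 0)"
      by (simp add: o_def case_prod_unfold)
    also have "\<dots> = (\<Sum>e\<leftarrow>es. max e 0)"
      by (subst map_fst_zip) (use es vs in auto)
    also have "\<dots> \<le> t" unfolding t_def by (intro sum_list_mono) auto
    finally show "(\<Sum>w\<leftarrow>ws. w \<bullet> w) \<le> t" .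
    show "g \<bullet> (A *\<^sub>v g) \<le> (\<Sum>w\<leftarrow>ws. (g \<bullet> w)\<^sup>2)" if g: "g \<in> carrier_vec d" for g
    proof -
      have "e * (g \<bullet> v)\<^sup>2 \<le> (g \<bullet> (sqrt (max e 0) \<cdot>\<^sub>v v))\<^sup>2" if "v \<in> carrier_vec d" for e v
        using g that by (simp add: scalar_prod_smult_distrib[of _ d] power_mult_distrib mult_right_mono)
      then show ?thesis
        unfolding vs(3)[OF g] ws_def map_map
        by (intro sum_list_mono) (auto dest!: set_zip_rightD vs(2))
    qed
  qed
qed

subsection \<open>Random sign vectors\<close>

primrec sign_vecs :: "nat \<Rightarrow> real vec set" where
  "sign_vecs 0 = {vNil}"
| "sign_vecs (Suc d) = vCons 1 ` sign_vecs d \<union> vCons (- 1) ` sign_vecs d"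

text \<open>The expectation under independent fair signs. The recursion of \<open>sign_vecs\<close>
  conditions on the first coordinate, which drives the moment computations by induction on
  \<open>d\<close>.\<close>

definition avg :: "nat \<Rightarrow> (real vec \<Rightarrow> real) \<Rightarrow> real" where
  "avg d F = (\<Sum>g\<in>sign_vecs d. F g) / 2 ^ d"

lemma sign_vecs_carrier: "g \<in> sign_vecs d \<Longrightarrow> g \<in> carrier_vec d"
  by (induction d arbitrary: g) auto

lemma finite_sign_vecs [simp]: "finite (sign_vecs d)"
  by (induction d) auto

lemma sum_sign_vecs_Suc:
  "(\<Sum>g\<in>sign_vecs (Suc d). F g) = (\<Sum>g\<in>sign_vecs d. F (vCons 1 g) + F (vCons (- 1) g))"
proof -
  have "(\<Sum>g\<in>sign_vecs (Suc d). F g) =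
      (\<Sum>g\<in>vCons 1 ` sign_vecs d. F g) + (\<Sum>g\<in>vCons (- 1) ` sign_vecs d. F g)"
    by (simp, subst sum.union_disjoint) auto
  also have "\<dots> = (\<Sum>g\<in>sign_vecs d. F (vCons 1 g)) + (\<Sum>g\<in>sign_vecs d. F (vCons (- 1) g))"
    by (subst (1 2) sum.reindex) (auto simp: inj_on_def)
  finally show ?thesis by (simp add: sum.distrib)
qed

lemma card_sign_vecs: "card (sign_vecs d) = 2 ^ d"
proof (induction d)
  case (Suc d)
  have "card (sign_vecs (Suc d)) = (\<Sum>g\<in>sign_vecs (Suc d). 1)" by simp
  also have "\<dots> = 2 ^ Suc d" unfolding sum_sign_vecs_Suc using Suc by simp
  finally show ?case .
qed simp

lemma avg_0 [simp]: "avg 0 F = F vNil"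
  by (simp add: avg_def)

lemma avg_Suc: "avg (Suc d) F = avg d (\<lambda>g. (F (vCons 1 g) + F (vCons (- 1) g)) / 2)"
  unfolding avg_def sum_sign_vecs_Suc by (simp add: sum_divide_distrib[symmetric])

lemma avg_const [simp]: "avg d (\<lambda>_. c) = c"
  by (simp add: avg_def card_sign_vecs)

lemma avg_add: "avg d (\<lambda>g. F g + G g) = avg d F + avg d G"
  by (simp add: avg_def sum.distrib add_divide_distrib)

lemma avg_diff: "avg d (\<lambda>g. F g - G g) = avg d F - avg d G"
  by (simp add: avg_def sum_subtractf diff_divide_distrib)

lemma avg_cmult: "avg d (\<lambda>g. c * F g) = c * avg d F"
  by (simp add: avg_def sum_distrib_left)

lemma avg_cong: "(\<And>g. g \<in> carrier_vec d \<Longrightarrow> F g = G g) \<Longrightarrow> avg d F = avg d G"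
  unfolding avg_def by (metis (no_types, lifting) sign_vecs_carrier sum.cong)

lemma avg_mono:
  assumes "\<And>g. g \<in> carrier_vec d \<Longrightarrow> F g \<le> G g"
  shows "avg d F \<le> avg d G"
  unfolding avg_def using assms by (intro divide_right_mono sum_mono) (auto dest: sign_vecs_carrier)

lemma avg_sum_list: "avg d (\<lambda>g. \<Sum>w\<leftarrow>ws. F w g) = (\<Sum>w\<leftarrow>ws. avg d (F w))"
  by (induction ws) (simp_all add: avg_add)

text \<open>Independent signs have identity covariance, as terms odd in the first sign cancel. Hence
  a descent step moves \<open>x\<close> on average by \<open>\<eta>\<close> times the negative of
  \<open>A *\<^sub>v x\<close>.\<close>

lemma avg_prod:
  assumes "u \<in> carrier_vec d" "w \<in> carrier_vec d"
  shows "avg d (\<lambda>g. (g \<bullet> u) * (g \<bullet> w)) = u \<bullet> w"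
  using assms
proof (induction d arbitrary: u w)
  case 0
  then show ?case by (simp add: scalar_prod_def)
next
  case (Suc d)
  obtain a u' b w' where uw: "u = vCons a u'" "w = vCons b w'"
    using Suc.prems by (cases u; cases w) auto
  have uw': "u' \<in> carrier_vec d" "w' \<in> carrier_vec d" using Suc.prems uw by auto
  have "avg (Suc d) (\<lambda>g. (g \<bullet> u) * (g \<bullet> w)) = avg d (\<lambda>g. (g \<bullet> u') * (g \<bullet> w') + a * b)"
    unfolding avg_Suc uw by (simp add: algebra_simps add_divide_distrib)
  also have "\<dots> = u \<bullet> w"
    using Suc.IH[OF uw'] by (simp add: avg_add uw)
  finally show ?case .
qed

text \<open>The constant 3 is the one for Gaussian vectors. Conditioning on the first sign leaves
  the cross term \<open>4 * a * b * (u' \<bullet> w')\<close>, which nonnegativity of the squared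
  length of \<open>b \<cdot>\<^sub>v u' - a \<cdot>\<^sub>v w'\<close> bounds by the mixed
  terms.\<close>

lemma avg_square_prod_le:
  assumes "u \<in> carrier_vec d" "w \<in> carrier_vec d"
  shows "avg d (\<lambda>g. (g \<bullet> u)\<^sup>2 * (g \<bullet> w)\<^sup>2) \<le> 3 * (u \<bullet> u) * (w \<bullet> w)"
  using assms
proof (induction d arbitrary: u w)
  case 0
  then show ?case by (simp add: scalar_prod_def)
next
  case (Suc d)
  obtain a u' b w' where uw: "u = vCons a u'" "w = vCons b w'"
    using Suc.prems by (cases u; cases w) auto
  have uw': "u' \<in> carrier_vec d" "w' \<in> carrier_vec d" using Suc.prems uw by auto
  have "avg (Suc d) (\<lambda>g. (g \<bullet> u)\<^sup>2 * (g \<bullet> w)\<^sup>2) =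
      avg d (\<lambda>g. (g \<bullet> u')\<^sup>2 * (g \<bullet> w')\<^sup>2 + b\<^sup>2 * ((g \<bullet> u') * (g \<bullet> u')) + a\<^sup>2 * ((g \<bullet> w') * (g \<bullet> w'))
        + 4 * a * b * ((g \<bullet> u') * (g \<bullet> w')) + a\<^sup>2 * b\<^sup>2)"
    unfolding avg_Suc uw by (intro avg_cong) (simp add: field_simps power2_eq_square)
  also have "\<dots> = avg d (\<lambda>g. (g \<bullet> u')\<^sup>2 * (g \<bullet> w')\<^sup>2) + b\<^sup>2 * (u' \<bullet> u') + a\<^sup>2 * (w' \<bullet> w')
        + 4 * a * b * (u' \<bullet> w') + a\<^sup>2 * b\<^sup>2"
    by (simp only: avg_add avg_cmult avg_prod uw' avg_const)
  also have "\<dots> \<le> 3 * (u' \<bullet> u') * (w' \<bullet> w') + b\<^sup>2 * (u' \<bullet> u') + a\<^sup>2 * (w' \<bullet> w')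
        + 4 * a * b * (u' \<bullet> w') + a\<^sup>2 * b\<^sup>2"
    using Suc.IH[OF uw'] by simp
  also have "\<dots> \<le> 3 * (u \<bullet> u) * (w \<bullet> w)"
  proof -
    have "0 \<le> (b \<cdot>\<^sub>v u' - a \<cdot>\<^sub>v w') \<bullet> (b \<cdot>\<^sub>v u' - a \<cdot>\<^sub>v w')"
      by (rule scalar_prod_self_nonneg)
    also have "\<dots> = b\<^sup>2 * (u' \<bullet> u') - 2 * a * b * (u' \<bullet> w') + a\<^sup>2 * (w' \<bullet> w')"
      using uw' comm_scalar_prod[of w' d u']
      by (simp add: minus_scalar_prod_distrib[of _ d] scalar_prod_minus_distrib[of _ d]
          smult_scalar_prod_distrib[of _ d] scalar_prod_smult_distrib[of _ d] power2_eq_square algebra_simps)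
    finally have "2 * a * b * (u' \<bullet> w') \<le> b\<^sup>2 * (u' \<bullet> u') + a\<^sup>2 * (w' \<bullet> w')" by simp
    moreover have "0 \<le> a\<^sup>2 * b\<^sup>2" by simp
    ultimately have "3 * (u' \<bullet> u') * (w' \<bullet> w') + b\<^sup>2 * (u' \<bullet> u') + a\<^sup>2 * (w' \<bullet> w')
        + 4 * a * b * (u' \<bullet> w') + a\<^sup>2 * b\<^sup>2 \<le>
        3 * (u' \<bullet> u') * (w' \<bullet> w') + 3 * (b\<^sup>2 * (u' \<bullet> u')) + 3 * (a\<^sup>2 * (w' \<bullet> w')) + 3 * (a\<^sup>2 * b\<^sup>2)"
      by linarith
    also have "\<dots> = 3 * (u \<bullet> u) * (w \<bullet> w)" by (simp add: uw algebra_simps power2_eq_square)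
    finally show ?thesis .
  qed
  finally show ?case .
qed

text \<open>Second-moment method: for \<open>z = (g \<bullet> u)\<^sup>2 / (u \<bullet> u)\<close> the quadratic
  \<open>(z - 1/4) / 2 - (z - 1/4)\<^sup>2 / 16\<close> lies below the indicator of \<open>z \<ge> 1/4\<close>.\<close>

lemma avg_anticoncentration:
  assumes u: "u \<in> carrier_vec d" "u \<bullet> u > 0" and t: "t > 0"
    and ws: "\<And>w. w \<in> set ws \<Longrightarrow> w \<in> carrier_vec d" "(\<Sum>w\<leftarrow>ws. w \<bullet> w) \<le> t"
  shows "avg d (\<lambda>g. of_bool ((g \<bullet> u)\<^sup>2 \<ge> (u \<bullet> u) / 4 \<and> (\<Sum>w\<leftarrow>ws. (g \<bullet> w)\<^sup>2) \<le> 16 * t)) \<ge> 1 / 8"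
proof -
  define s where "s = u \<bullet> u"
  have s: "s > 0" using u by (simp add: s_def)
  define N where "N = (\<lambda>g. \<Sum>w\<leftarrow>ws. (g \<bullet> w)\<^sup>2)"
  have N: "avg d N \<le> t"
  proof -
    have "avg d N = (\<Sum>w\<leftarrow>ws. w \<bullet> w)"
      unfolding N_def avg_sum_list using ws(1)
      by (intro arg_cong[of _ _ sum_list] map_cong) (auto simp: power2_eq_square avg_prod)
    then show ?thesis using ws(2) by simp
  qed
  have m2: "avg d (\<lambda>g. (g \<bullet> u)\<^sup>2) = s" using avg_prod[OF u(1) u(1)] by (simp add: power2_eq_square s_def)
  have m4: "avg d (\<lambda>g. (g \<bullet> u)\<^sup>2 * (g \<bullet> u)\<^sup>2) \<le> 3 * s * s" unfolding s_def by (rule avg_square_prod_le[OF u(1) u(1)])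
  \<comment> \<open>The quadratic above, expanded in powers of \<open>z\<close>; the last summand
    handles \<open>N g > 16 * t\<close> in the manner of Markov's inequality.\<close>
  let ?c = "\<lambda>g. (- 33 / 256) + (17 / (32 * s)) * (g \<bullet> u)\<^sup>2 - (1 / (16 * s * s)) * ((g \<bullet> u)\<^sup>2 * (g \<bullet> u)\<^sup>2)
      - (1 / (16 * t)) * N g"
  have "?c g \<le> of_bool ((g \<bullet> u)\<^sup>2 \<ge> (u \<bullet> u) / 4 \<and> N g \<le> 16 * t)" if "g \<in> carrier_vec d" for g
  proof -
    define z where "z = (g \<bullet> u)\<^sup>2 / s"
    define y where "y = N g / (16 * t)"
    have y: "y \<ge> 0" unfolding y_def N_def using t by (auto intro!: divide_nonneg_nonneg sum_list_nonneg)
    have z: "z \<ge> 0" unfolding z_def using s by simp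
    have c: "?c g = (z - 1/4) / 2 - (z - 1/4)\<^sup>2 / 16 - y"
      using s t by (simp add: z_def y_def field_simps power2_eq_square)
    have eq: "(g \<bullet> u)\<^sup>2 \<ge> (u \<bullet> u) / 4 \<longleftrightarrow> z \<ge> 1 / 4" "N g \<le> 16 * t \<longleftrightarrow> y \<le> 1"
      using s t by (auto simp: z_def y_def s_def field_simps)
    have "0 \<le> ((z - 1/4) / 4 - 1)\<^sup>2" by simp
    then have "(z - 1/4) / 2 - (z - 1/4)\<^sup>2 / 16 \<le> 1" by (simp add: power2_eq_square algebra_simps)
    moreover have neg: "(z - 1/4) / 2 - q / 16 \<le> 0" if "z < 1/4" "q \<ge> 0" for q
    proof -
      have "(z - 1/4) / 2 \<le> 0" "q / 16 \<ge> 0" using that by simp_all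
      then show ?thesis by (rule diff_le_0_iff_le[THEN iffD2, OF order_trans])
    qed
    from neg[OF _ zero_le_power2] have "(z - 1/4) / 2 - (z - 1/4)\<^sup>2 / 16 \<le> 0" if "z < 1/4"
      using that by blast
    moreover have "r - y \<le> of_bool (z \<ge> 1/4 \<and> y \<le> 1)" if "r \<le> 1" "z < 1/4 \<Longrightarrow> r \<le> 0" for r
      using that y by (cases "z < 1/4") auto
    ultimately show ?thesis unfolding c eq by blast
  qed
  then have "avg d ?c \<le> avg d (\<lambda>g. of_bool ((g \<bullet> u)\<^sup>2 \<ge> (u \<bullet> u) / 4 \<and> N g \<le> 16 * t))"
    by (rule avg_mono)
  moreover have "avg d ?c \<ge> 1 / 8"
  proof -
    have "avg d ?c = - 33 / 256 + (17 / (32 * s)) * s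
        - (1 / (16 * s * s)) * avg d (\<lambda>g. (g \<bullet> u)\<^sup>2 * (g \<bullet> u)\<^sup>2) - (1 / (16 * t)) * avg d N"
      by (simp only: avg_add avg_diff avg_cmult avg_const m2)
    also have "\<dots> \<ge> - 33 / 256 + (17 / (32 * s)) * s - (1 / (16 * s * s)) * (3 * s * s) - (1 / (16 * t)) * t"
      using m4 N s t by (intro diff_mono mult_left_mono) auto
    \<comment> \<open>The normalized moments 1 and 3 and the Markov loss 1/16 leave 39/256, just
      above 32/256.\<close>
    also have "- 33 / 256 + (17 / (32 * s)) * s - (1 / (16 * s * s)) * (3 * s * s) - (1 / (16 * t)) * t = 39 / 256"
      using s t by (simp add: field_simps)
    finally show ?thesis by simp
  qed
  ultimately show ?thesis unfolding N_def by linarith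
qed

subsection \<open>Stochastic descent\<close>

text \<open>One step of stochastic coordinate descent on \<open>x \<mapsto> x \<bullet> A x\<close> in direction \<open>g\<close>; it passes if
  the restriction of the form to the span of \<open>x\<close> and \<open>g\<close> is not seen to be indefinite.\<close>

definition passes :: "real mat \<Rightarrow> real vec \<Rightarrow> real vec \<Rightarrow> bool" where
  "passes A x g \<longleftrightarrow> x \<bullet> (A *\<^sub>v x) \<ge> 0 \<and> (g \<bullet> (A *\<^sub>v x))\<^sup>2 \<le> (x \<bullet> (A *\<^sub>v x)) * (g \<bullet> (A *\<^sub>v g))"

definition step :: "real mat \<Rightarrow> real \<Rightarrow> real vec \<Rightarrow> real vec \<Rightarrow> real vec" where
  "step A \<eta> x g = x - (\<eta> * (g \<bullet> (A *\<^sub>v x))) \<cdot>\<^sub>v g"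

primrec survives :: "real mat \<Rightarrow> real \<Rightarrow> real vec \<Rightarrow> real vec list \<Rightarrow> bool" where
  "survives A \<eta> x [] = True"
| "survives A \<eta> x (g # gs) \<longleftrightarrow> passes A x g \<and> survives A \<eta> (step A \<eta> x g) gs"

text \<open>The expectation over independent sign vectors, iterated rather than taken over lists, so
  that \<open>survival\<close> obeys a one-step Markov recursion; \<open>avgs_eq_card\<close> turns
  it into counting.\<close>

primrec avgs :: "nat \<Rightarrow> nat \<Rightarrow> (real vec list \<Rightarrow> real) \<Rightarrow> real" where
  "avgs d 0 F = F []"
| "avgs d (Suc n) F = avg d (\<lambda>g. avgs d n (\<lambda>gs. F (g # gs)))"

definition survival :: "nat \<Rightarrow> real mat \<Rightarrow> real \<Rightarrow> nat \<Rightarrow> real vec \<Rightarrow> real" where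
  "survival d A \<eta> n x = avgs d n (\<lambda>gs. of_bool (survives A \<eta> x gs))"

lemma avgs_mono:
  "(\<And>gs. set gs \<subseteq> carrier_vec d \<Longrightarrow> F gs \<le> G gs) \<Longrightarrow> avgs d n F \<le> avgs d n G"
proof (induction n arbitrary: F G)
  case (Suc n)
  show ?case
    unfolding avgs.simps by (intro avg_mono Suc.IH Suc.prems) auto
qed simp

lemma avgs_const [simp]: "avgs d n (\<lambda>_. c) = c"
  by (induction n) simp_all

lemma survival_Suc:
  "survival d A \<eta> (Suc n) x = avg d (\<lambda>g. of_bool (passes A x g) * survival d A \<eta> n (step A \<eta> x g))"
  unfolding survival_def avgs.simps by (intro avg_cong) (simp add: of_bool_conj)

lemma survival_le_1: "survival d A \<eta> n x \<le> 1"
  using avgs_mono[of d "\<lambda>gs. of_bool (survives A \<eta> x gs)" "\<lambda>_. 1"] by (simp add: survival_def)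

lemma survival_nonneg: "survival d A \<eta> n x \<ge> 0"
  using avgs_mono[of d "\<lambda>_. 0" "\<lambda>gs. of_bool (survives A \<eta> x gs)"] by (simp add: survival_def)

lemma step_carrier:
  "x \<in> carrier_vec d \<Longrightarrow> g \<in> carrier_vec d \<Longrightarrow> step A \<eta> x g \<in> carrier_vec d"
  by (simp add: step_def)

section \<open>Drift of the energy and of the negative component\<close>

text \<open>What the analysis of the descent keeps of a matrix far from PSD. The sum of squares over
  \<open>ws\<close> dominates the form and, by \<open>avg_prod\<close>, has mean at most
  \<open>t\<close> over random signs.\<close>

locale indefinite_form =
  fixes d :: nat and A :: "real mat" and v :: "real vec" and ws :: "real vec list" and l t :: real
  assumes A: "A \<in> carrier_mat d d" "transpose_mat A = A"
    and v: "v \<in> carrier_vec d" "v \<bullet> v = 1" "A *\<^sub>v v = (- l) \<cdot>\<^sub>v v"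
    and l: "l > 0" and t: "t > 0"
    and ws: "\<And>w. w \<in> set ws \<Longrightarrow> w \<in> carrier_vec d" "(\<Sum>w\<leftarrow>ws. w \<bullet> w) \<le> t"
    and form_le: "\<And>g. g \<in> carrier_vec d \<Longrightarrow> g \<bullet> (A *\<^sub>v g) \<le> (\<Sum>w\<leftarrow>ws. (g \<bullet> w)\<^sup>2)"
begin

definition q where "q x = x \<bullet> (A *\<^sub>v x)"
definition S where "S x = (A *\<^sub>v x) \<bullet> (A *\<^sub>v x)"
definition N where "N g = (\<Sum>w\<leftarrow>ws. (g \<bullet> w)\<^sup>2)"

lemma N_nonneg: "N g \<ge> 0"
  unfolding N_def by (intro sum_list_nonneg) auto

lemma q_le_N: "g \<in> carrier_vec d \<Longrightarrow> q g \<le> N g"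
  unfolding q_def N_def by (rule form_le)

lemma S_nonneg: "S x \<ge> 0"
  unfolding S_def by (rule scalar_prod_self_nonneg)

lemma Av_prod: "x \<in> carrier_vec d \<Longrightarrow> (A *\<^sub>v x) \<bullet> v = - l * (x \<bullet> v)"
  using symmetric_scalar_prod[OF A, of x v] v A comm_scalar_prod[of "A *\<^sub>v x" d v]
  by (simp add: scalar_prod_smult_distrib[of _ d])

text \<open>The vector \<open>A *\<^sub>v x\<close> is at least as long as its component along the
  unit vector \<open>v\<close>, which \<open>Av_prod\<close> evaluates.\<close>

lemma S_ge:
  assumes "x \<in> carrier_vec d"
  shows "S x \<ge> l\<^sup>2 * (x \<bullet> v)\<^sup>2"
proof -
  define u where "u = A *\<^sub>v x"
  have u: "u \<in> carrier_vec d" using A assms by (simp add: u_def)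
  have "0 \<le> (u - (u \<bullet> v) \<cdot>\<^sub>v v) \<bullet> (u - (u \<bullet> v) \<cdot>\<^sub>v v)" by (rule scalar_prod_self_nonneg)
  also have "\<dots> = u \<bullet> u - (u \<bullet> v)\<^sup>2"
    using u v comm_scalar_prod[of v d u]
    by (simp add: minus_scalar_prod_distrib[of _ d] scalar_prod_minus_distrib[of _ d]
        smult_scalar_prod_distrib[of _ d] scalar_prod_smult_distrib[of _ d] power2_eq_square algebra_simps)
  finally show ?thesis
    using Av_prod[OF assms] by (simp add: S_def u_def power_mult_distrib)
qed

lemma q_step:
  assumes "x \<in> carrier_vec d" "g \<in> carrier_vec d"
  defines "a \<equiv> g \<bullet> (A *\<^sub>v x)"
  shows "q (step A \<eta> x g) = q x - 2 * \<eta> * a\<^sup>2 + \<eta>\<^sup>2 * a\<^sup>2 * q g"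
proof -
  have sym: "x \<bullet> (A *\<^sub>v g) = a" unfolding a_def by (rule symmetric_scalar_prod[OF A assms(1,2)])
  have "A *\<^sub>v step A \<eta> x g = A *\<^sub>v x - (\<eta> * a) \<cdot>\<^sub>v (A *\<^sub>v g)"
    unfolding step_def a_def using A assms by (simp add: mult_minus_distrib_mat_vec[of _ d d] mult_mat_vec)
  then show ?thesis
    unfolding q_def using A assms(1,2) sym
    by (simp add: step_def a_def[symmetric] minus_scalar_prod_distrib[of _ d] scalar_prod_minus_distrib[of _ d]
        smult_scalar_prod_distrib[of _ d] scalar_prod_smult_distrib[of _ d] power2_eq_square algebra_simps)
qed

lemma v_step:
  assumes "x \<in> carrier_vec d" "g \<in> carrier_vec d"
  shows "step A \<eta> x g \<bullet> v = x \<bullet> v - \<eta> * (g \<bullet> (A *\<^sub>v x)) * (g \<bullet> v)"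
  using assms v by (simp add: step_def minus_scalar_prod_distrib[of _ d] smult_scalar_prod_distrib[of _ d])

text \<open>With probability at least 1/8 the direction \<open>g\<close> sees a quarter of
  \<open>S x\<close> while \<open>N g \<le> 16 * t\<close>. Passing would then give
  \<open>S x / 4 \<le> 16 * t * q x\<close>, whereas the right side is at most
  \<open>96 * \<eta> * t * S x\<close>, hence at most 96/400 of \<open>S x\<close>. So a single step
  fails with that probability.\<close>

lemma survival_le_good:
  assumes x: "x \<in> carrier_vec d" and qx: "q x \<ge> 0"
    and \<eta>: "\<eta> * S x > q x / 6" "0 < \<eta>" "\<eta> * t \<le> 1 / 400"
  shows "survival d A \<eta> (Suc n) x \<le> 7 / 8"
proof -
  have S0: "S x > 0" using \<eta> qx by (smt (verit) zero_less_mult_pos divide_nonneg_nonneg)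
  have u: "A *\<^sub>v x \<in> carrier_vec d" using A x by simp
  let ?G = "\<lambda>g. (g \<bullet> (A *\<^sub>v x))\<^sup>2 \<ge> S x / 4 \<and> N g \<le> 16 * t"
  have G: "avg d (\<lambda>g. of_bool (?G g)) \<ge> 1 / 8"
    using avg_anticoncentration[OF u _ t ws] S0 unfolding S_def N_def by blast
  have "survival d A \<eta> (Suc n) x \<le> avg d (\<lambda>g. 1 - of_bool (?G g))"
    unfolding survival_Suc
  proof (rule avg_mono)
    fix g :: "real vec" assume g: "g \<in> carrier_vec d"
    have "\<not> passes A x g" if "?G g"
    proof
      assume p: "passes A x g"
      have "S x / 4 \<le> q x * q g" using p that unfolding passes_def q_def by linarith
      also have "\<dots> \<le> q x * (16 * t)" using q_le_N[OF g] that qx by (intro mult_left_mono) auto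
      also have "\<dots> \<le> (6 * \<eta> * S x) * (16 * t)" using \<eta>(1) t by (intro mult_right_mono) auto
      also have "\<dots> = 96 * S x * (\<eta> * t)" by simp
      also have "\<dots> \<le> 96 * S x * (1 / 400)" using \<eta>(3) S0 by (intro mult_left_mono) auto
      finally show False using S0 by simp
    qed
    then show "of_bool (passes A x g) * survival d A \<eta> n (step A \<eta> x g) \<le> 1 - of_bool (?G g)"
      using survival_le_1[of d A \<eta> n "step A \<eta> x g"] survival_nonneg[of d A \<eta> n "step A \<eta> x g"] by auto
  qed
  also have "\<dots> = 1 - avg d (\<lambda>g. of_bool (?G g))" by (simp only: avg_diff avg_const)
  finally show ?thesis using G by simp
qed

text \<open>An upper bound for \<open>q\<close> after a step that is nonnegative even when the true value is not.\<close>

definition Q where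
  "Q \<eta> x g = q x - 2 * \<eta> * (g \<bullet> (A *\<^sub>v x))\<^sup>2 + (\<eta>\<^sup>2 / q x) * ((g \<bullet> (A *\<^sub>v x))\<^sup>2 * (g \<bullet> (A *\<^sub>v x))\<^sup>2)
    + \<eta>\<^sup>2 * ((g \<bullet> (A *\<^sub>v x))\<^sup>2 * N g)"

text \<open>The first three terms of \<open>Q\<close> form a perfect square, and the last is
  nonnegative.\<close>

lemma Q_nonneg:
  assumes "q x > 0"
  shows "Q \<eta> x g \<ge> 0"
proof -
  define a where "a = (g \<bullet> (A *\<^sub>v x))\<^sup>2"
  have "Q \<eta> x g = q x * (1 - \<eta> * a / q x)\<^sup>2 + \<eta>\<^sup>2 * (a * N g)"
    unfolding Q_def a_def[symmetric] using assms by (simp add: power2_eq_square field_simps)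
  then show ?thesis using assms N_nonneg[of g] by (simp add: a_def)
qed

lemma q_step_le_Q:
  assumes "x \<in> carrier_vec d" "g \<in> carrier_vec d" "q x > 0"
  shows "q (step A \<eta> x g) \<le> Q \<eta> x g"
proof -
  define a where "a = (g \<bullet> (A *\<^sub>v x))\<^sup>2"
  have "\<eta>\<^sup>2 * a * q g \<le> \<eta>\<^sup>2 * a * N g"
    using q_le_N[OF assms(2)] by (intro mult_left_mono) (auto simp: a_def)
  moreover have "0 \<le> (\<eta>\<^sup>2 / q x) * (a * a)" using assms by (simp add: a_def)
  ultimately show ?thesis
    unfolding q_step[OF assms(1,2)] Q_def a_def[symmetric] by (simp add: mult.assoc)
qed

text \<open>The linear gain \<open>2 * \<eta> * S x\<close> pays for both quadratic terms: the
  fourth moment costs at most half of \<open>\<eta> * S x\<close> because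
  \<open>\<eta> * S x \<le> q x / 6\<close>, and the curvature along \<open>g\<close> at most 3/400
  of it.\<close>

lemma avg_Q_le:
  assumes x: "x \<in> carrier_vec d" and qx: "q x > 0"
    and \<eta>: "\<eta> * S x \<le> q x / 6" "0 < \<eta>" "\<eta> * t \<le> 1 / 400"
  shows "avg d (Q \<eta> x) \<le> q x - \<eta> * S x"
proof -
  have u: "A *\<^sub>v x \<in> carrier_vec d" using A x by simp
  let ?a = "\<lambda>g. (g \<bullet> (A *\<^sub>v x))\<^sup>2"
  have m2: "avg d ?a = S x"
    using avg_prod[OF u u] by (simp add: S_def power2_eq_square)
  have m4: "avg d (\<lambda>g. ?a g * ?a g) \<le> 3 * S x * S x"
    using avg_square_prod_le[OF u u] by (simp add: S_def)
  have mN: "avg d (\<lambda>g. ?a g * N g) \<le> 3 * S x * t"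
  proof -
    have "avg d (\<lambda>g. ?a g * N g) = (\<Sum>w\<leftarrow>ws. avg d (\<lambda>g. ?a g * (g \<bullet> w)\<^sup>2))"
      unfolding N_def sum_list_const_mult[symmetric] by (rule avg_sum_list)
    also have "\<dots> \<le> (\<Sum>w\<leftarrow>ws. 3 * S x * (w \<bullet> w))"
      using avg_square_prod_le[OF u] ws(1) by (intro sum_list_mono) (simp add: S_def)
    also have "\<dots> \<le> 3 * S x * t"
      unfolding sum_list_const_mult using ws(2) S_nonneg[of x] by (intro mult_left_mono) auto
    finally show ?thesis .
  qed
  have "avg d (Q \<eta> x) = q x - 2 * \<eta> * S x + (\<eta>\<^sup>2 / q x) * avg d (\<lambda>g. ?a g * ?a g)
      + \<eta>\<^sup>2 * avg d (\<lambda>g. ?a g * N g)"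
    unfolding Q_def by (simp only: avg_add avg_diff avg_cmult avg_const m2)
  also have "\<dots> \<le> q x - 2 * \<eta> * S x + (\<eta>\<^sup>2 / q x) * (3 * S x * S x) + \<eta>\<^sup>2 * (3 * S x * t)"
    using m4 mN qx by (intro add_mono mult_left_mono) auto
  also have "(\<eta>\<^sup>2 / q x) * (3 * S x * S x) = 3 * (\<eta> * S x) * (\<eta> * S x / q x)"
    by (simp add: power2_eq_square)
  also have "\<dots> \<le> 3 * (\<eta> * S x) * (1 / 6)"
    using \<eta> qx S_nonneg[of x] by (intro mult_left_mono) (auto simp: field_simps)
  also have "\<eta>\<^sup>2 * (3 * S x * t) = 3 * (\<eta> * S x) * (\<eta> * t)"
    by (simp add: power2_eq_square)
  also have "\<dots> \<le> 3 * (\<eta> * S x) * (1 / 400)"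
    using \<eta> S_nonneg[of x] by (intro mult_left_mono) auto
  finally have "avg d (Q \<eta> x) \<le> q x - \<eta> * S x - (197 / 400) * (\<eta> * S x)" by simp
  moreover have "0 \<le> \<eta> * S x" using \<eta>(2) S_nonneg[of x] by simp
  ultimately show ?thesis by linarith
qed

text \<open>Bias and variance: as \<open>v\<close> has eigenvalue \<open>- l\<close>, the mean of
  the component along \<open>v\<close> grows exactly by the factor \<open>1 + \<eta> * l\<close>,
  and the random part has variance at most \<open>3 * \<eta>\<^sup>2 * S x\<close>.\<close>

lemma avg_v_step_le:
  assumes x: "x \<in> carrier_vec d"
  shows "avg d (\<lambda>g. (step A \<eta> x g \<bullet> v - (1 + \<eta> * l) * Y)\<^sup>2) \<le>
    (1 + \<eta> * l)\<^sup>2 * (x \<bullet> v - Y)\<^sup>2 + 3 * \<eta>\<^sup>2 * S x"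
proof -
  have u: "A *\<^sub>v x \<in> carrier_vec d" using A x by simp
  define y where "y = x \<bullet> v"
  define c where "c = y - (1 + \<eta> * l) * Y"
  let ?p = "\<lambda>g. (g \<bullet> (A *\<^sub>v x)) * (g \<bullet> v)"
  let ?r = "\<lambda>g. (g \<bullet> (A *\<^sub>v x))\<^sup>2 * (g \<bullet> v)\<^sup>2"
  have m: "avg d ?p = - l * y"
    using avg_prod[OF u v(1)] Av_prod[OF x] by (simp add: y_def)
  have r: "avg d ?r \<le> 3 * S x"
    using avg_square_prod_le[OF u v(1)] v(2) by (simp add: S_def)
  have "avg d (\<lambda>g. (step A \<eta> x g \<bullet> v - (1 + \<eta> * l) * Y)\<^sup>2) = avg d (\<lambda>g. c\<^sup>2 - 2 * c * \<eta> * ?p g + \<eta>\<^sup>2 * ?r g)"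
    by (intro avg_cong) (simp add: v_step[OF x] c_def y_def power2_eq_square algebra_simps)
  also have "\<dots> = c\<^sup>2 - 2 * c * \<eta> * (- l * y) + \<eta>\<^sup>2 * avg d ?r"
    by (simp only: avg_add avg_diff avg_cmult avg_const m)
  also have "\<dots> \<le> c\<^sup>2 - 2 * c * \<eta> * (- l * y) + \<eta>\<^sup>2 * (3 * S x)"
    using r by (intro add_left_mono mult_left_mono) auto
  \<comment> \<open>Completing the square: \<open>c + \<eta> * l * y\<close> equals
    \<open>(1 + \<eta> * l) * (y - Y)\<close>.\<close>
  also have "c\<^sup>2 - 2 * c * \<eta> * (- l * y) = (1 + \<eta> * l)\<^sup>2 * (y - Y)\<^sup>2 - (\<eta> * l * y)\<^sup>2"
    by (simp add: c_def power2_eq_square algebra_simps)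
  also have "\<dots> \<le> (1 + \<eta> * l)\<^sup>2 * (y - Y)\<^sup>2" by simp
  finally show ?thesis by (simp add: y_def mult_ac)
qed


text \<open>\<open>Y\<close> tracks the expected value of \<open>x \<bullet> v\<close>, which grows by the factor \<open>1 + \<eta> l\<close> per step; the
  noise this tracking picks up is paid for by the decrease of \<open>q\<close>.  When the potential on the right is
  below 1 at the end, \<open>S\<close> is so large compared with \<open>q\<close> that the last step fails with constant
  probability.\<close>

lemma survival_le_potential:
  assumes "x \<in> carrier_vec d" "q x \<ge> 0" "Y \<noteq> 0"
    and \<eta>: "0 < \<eta>" "\<eta> * t \<le> 1 / 400" and B: "B > 0" "12 * \<eta> \<le> B * Y\<^sup>2"
    and "1 \<le> B * \<eta> * l\<^sup>2 * Y\<^sup>2 * (1 + \<eta> * l) ^ (2 * n)"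
  shows "survival d A \<eta> (Suc n) x \<le> 7 / 8 + 4 * (x \<bullet> v - Y)\<^sup>2 / Y\<^sup>2 + B * q x"
proof -
  have ge1: "4 * w / y\<^sup>2 \<ge> 1" if "w \<ge> y\<^sup>2 / 4" "y \<noteq> 0" for w y :: real
    using that by (simp add: le_divide_eq)
  show ?thesis
    using assms(1-3,7,8)
  proof (induction n arbitrary: x Y)
    case 0
    show ?case
    \<comment> \<open>If all three inequalities hold, then
      \<open>\<bar>x \<bullet> v\<bar> \<ge> \<bar>Y\<bar> / 2\<close> and the growth hypothesis
      yield 1/4 < 1/6. Otherwise the potential is at least 1 or \<open>survival_le_good\<close>
      applies.\<close>
    proof (cases "(x \<bullet> v - Y)\<^sup>2 < Y\<^sup>2 / 4 \<and> B * q x < 1 \<and> q x / 6 \<ge> \<eta> * S x")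
      case True
      have "(x \<bullet> v)\<^sup>2 \<ge> Y\<^sup>2 / 4"
      proof -
        have "\<bar>x \<bullet> v - Y\<bar> < \<bar>Y\<bar> / 2"
          using True by (intro power2_less_imp_less[of _ "\<bar>Y\<bar> / 2"]) (auto simp: power_divide)
        then have "\<bar>Y\<bar> / 2 \<le> \<bar>x \<bullet> v\<bar>" by linarith
        then have "(\<bar>Y\<bar> / 2)\<^sup>2 \<le> \<bar>x \<bullet> v\<bar>\<^sup>2" by (intro power_mono) auto
        then show ?thesis by (simp add: power_divide)
      qed
      then have "l\<^sup>2 * (Y\<^sup>2 / 4) \<le> l\<^sup>2 * (x \<bullet> v)\<^sup>2" by (intro mult_left_mono) auto
      also have "\<dots> \<le> S x" using S_ge 0 by blast
      finally have "B * \<eta> * (l\<^sup>2 * (Y\<^sup>2 / 4)) \<le> B * \<eta> * S x" using \<eta> B by (intro mult_left_mono) auto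
      also have "\<dots> = B * (\<eta> * S x)" by simp
      also have "\<dots> \<le> B * (q x / 6)" using True B by (intro mult_left_mono) auto
      finally have "B * \<eta> * l\<^sup>2 * Y\<^sup>2 / 4 \<le> B * q x / 6" by simp
      moreover have "1 \<le> B * \<eta> * l\<^sup>2 * Y\<^sup>2" using 0(5) by simp
      ultimately have False using True by linarith
      then show ?thesis ..
    next
      case False
      have pos: "4 * (x \<bullet> v - Y)\<^sup>2 / Y\<^sup>2 \<ge> 0" "B * q x \<ge> 0" using 0 B by auto
      consider "(x \<bullet> v - Y)\<^sup>2 \<ge> Y\<^sup>2 / 4" | "B * q x \<ge> 1" | "q x / 6 < \<eta> * S x" using False by linarith
      then show ?thesis
      proof cases
        case 1
        then have "4 * (x \<bullet> v - Y)\<^sup>2 / Y\<^sup>2 \<ge> 1" using 0(3) by (rule ge1)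
        then show ?thesis using survival_le_1[of d A \<eta> "Suc 0" x] pos by linarith
      next
        case 2
        then show ?thesis using survival_le_1[of d A \<eta> "Suc 0" x] pos by linarith
      next
        case 3
        then show ?thesis using survival_le_good[OF 0(1,2) 3 \<eta>, of 0] pos by linarith
      qed
    qed
  next
    case (Suc n)
    define \<gamma> where "\<gamma> = 1 + \<eta> * l"
    define \<delta> where "\<delta> = (7 / 8 :: real)"
    have \<gamma>: "\<gamma> \<ge> 1" using \<eta> l by (simp add: \<gamma>_def)
    have pos: "4 * (x \<bullet> v - Y)\<^sup>2 / Y\<^sup>2 \<ge> 0" "B * q x \<ge> 0" using Suc.prems B by auto
    show ?case
    proof (cases "q x / 6 < \<eta> * S x")
      case True
      then show ?thesis using survival_le_good[OF Suc.prems(1,2) True \<eta>, of "Suc n"] pos by linarith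
    next
      case le: False
      show ?thesis
      proof (cases "q x = 0 \<or> (x \<bullet> v - Y)\<^sup>2 \<ge> Y\<^sup>2 / 4")
        case True
        \<comment> \<open>If \<open>q x = 0\<close>, then \<open>\<eta> * S x \<le> q x / 6\<close>
          forces \<open>S x = 0\<close> and thus \<open>x \<bullet> v = 0\<close>, at distance
          \<open>\<bar>Y\<bar>\<close> from \<open>Y\<close>.\<close>
        have "(x \<bullet> v - Y)\<^sup>2 \<ge> Y\<^sup>2 / 4"
        proof (rule ccontr)
          assume *: "\<not> (x \<bullet> v - Y)\<^sup>2 \<ge> Y\<^sup>2 / 4"
          then have "q x = 0" using True by simp
          then have "S x = 0" using le S_nonneg[of x] \<eta> by (simp add: not_less mult_le_0_iff)
          then have "x \<bullet> v = 0" using S_ge[OF Suc.prems(1)] l by (simp add: mult_le_0_iff)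
          then show False using * by simp
        qed
        then have "4 * (x \<bullet> v - Y)\<^sup>2 / Y\<^sup>2 \<ge> 1" using Suc.prems(3) by (rule ge1)
        then show ?thesis using survival_le_1[of d A \<eta> "Suc (Suc n)" x] pos by linarith
      next
        case False
        then have qx: "q x > 0" using Suc.prems by simp
        have le: "\<eta> * S x \<le> q x / 6" using le by simp
        define Y' where "Y' = \<gamma> * Y"
        have Y': "Y' \<noteq> 0" "Y'\<^sup>2 = \<gamma>\<^sup>2 * Y\<^sup>2" using \<gamma> Suc.prems by (auto simp: Y'_def power_mult_distrib)
        have split: "(4 / (c * y)) * (c * D + 3 * \<eta>\<^sup>2 * s) = 4 * D / y + (\<eta> * s) * (12 * \<eta> / (c * y))"
          if "c \<noteq> 0" "y \<noteq> 0" for c y D s :: real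
          using that by (simp add: distrib_left power2_eq_square)
        have g2: "1 \<le> \<gamma>\<^sup>2" using \<gamma> by (simp add: one_le_power)
        have B': "12 * \<eta> \<le> B * Y'\<^sup>2"
        proof -
          have "B * Y\<^sup>2 * 1 \<le> B * Y\<^sup>2 * \<gamma>\<^sup>2" using g2 B by (intro mult_left_mono) auto
          also have "B * Y\<^sup>2 * \<gamma>\<^sup>2 = B * Y'\<^sup>2" unfolding Y'(2) by (simp only: mult_ac)
          finally show ?thesis using Suc.prems(4) by linarith
        qed
        \<comment> \<open>Multiplying \<open>Y\<close> by \<open>\<gamma>\<close> makes up for the
          two powers of \<open>\<gamma>\<close> lost when the number of steps drops by one.\<close>
        have n': "1 \<le> B * \<eta> * l\<^sup>2 * Y'\<^sup>2 * \<gamma> ^ (2 * n)"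
        proof -
          have "\<gamma> ^ (2 * Suc n) = \<gamma>\<^sup>2 * \<gamma> ^ (2 * n)" by (simp add: power2_eq_square)
          then have "B * \<eta> * l\<^sup>2 * Y\<^sup>2 * \<gamma> ^ (2 * Suc n) = B * \<eta> * l\<^sup>2 * Y'\<^sup>2 * \<gamma> ^ (2 * n)"
            by (simp only: Y' mult_ac)
          then show ?thesis using Suc.prems(5)[folded \<gamma>_def] by linarith
        qed
        let ?x = "step A \<eta> x"
        have "survival d A \<eta> (Suc (Suc n)) x \<le>
            avg d (\<lambda>g. \<delta> + (4 / Y'\<^sup>2) * (?x g \<bullet> v - \<gamma> * Y)\<^sup>2 + B * Q \<eta> x g)"
          unfolding survival_Suc[of d A \<eta> "Suc n"]
        proof (rule avg_mono)
          fix g :: "real vec" assume g: "g \<in> carrier_vec d"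
          have c: "?x g \<in> carrier_vec d" using Suc.prems(1) g by (rule step_carrier)
          have p: "0 \<le> (4 / Y'\<^sup>2) * (?x g \<bullet> v - \<gamma> * Y)\<^sup>2" "0 \<le> B * Q \<eta> x g" "0 \<le> \<delta>"
            using Q_nonneg[OF qx] B by (auto simp: \<delta>_def)
          have "survival d A \<eta> (Suc n) (?x g) \<le> \<delta> + (4 / Y'\<^sup>2) * (?x g \<bullet> v - \<gamma> * Y)\<^sup>2 + B * Q \<eta> x g"
          proof (cases "q (?x g) \<ge> 0")
            case True
            have "survival d A \<eta> (Suc n) (?x g) \<le> \<delta> + 4 * (?x g \<bullet> v - Y')\<^sup>2 / Y'\<^sup>2 + B * q (?x g)"
              using Suc.IH[OF c True Y'(1) B'] n' unfolding \<gamma>_def \<delta>_def by blast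
            also have "B * q (?x g) \<le> B * Q \<eta> x g"
              using q_step_le_Q[OF Suc.prems(1) g qx] B by (intro mult_left_mono) auto
            finally show ?thesis by (simp add: Y'_def)
          next
            case False
            \<comment> \<open>Negative energy is rejected at the next step, so here nonnegativity of
              the bound suffices.\<close>
            then have "\<not> passes A (?x g) h" for h by (simp add: passes_def q_def)
            then have "survival d A \<eta> (Suc n) (?x g) = 0" by (simp add: survival_Suc)
            then show ?thesis using p by linarith
          qed
          moreover have "of_bool (passes A x g) * survival d A \<eta> (Suc n) (?x g) \<le> survival d A \<eta> (Suc n) (?x g)"
            using survival_nonneg[of d A \<eta> "Suc n" "?x g"] by (cases "passes A x g") auto
          ultimately show "of_bool (passes A x g) * survival d A \<eta> (Suc n) (?x g) \<le>
              \<delta> + (4 / Y'\<^sup>2) * (?x g \<bullet> v - \<gamma> * Y)\<^sup>2 + B * Q \<eta> x g" by linarith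
        qed
        also have "\<dots> = \<delta> + (4 / Y'\<^sup>2) * avg d (\<lambda>g. (?x g \<bullet> v - \<gamma> * Y)\<^sup>2) + B * avg d (Q \<eta> x)"
          by (simp only: avg_add avg_cmult avg_const)
        also have "\<dots> \<le> \<delta> + (4 / Y'\<^sup>2) * (\<gamma>\<^sup>2 * (x \<bullet> v - Y)\<^sup>2 + 3 * \<eta>\<^sup>2 * S x) + B * (q x - \<eta> * S x)"
          using avg_v_step_le[OF Suc.prems(1)] avg_Q_le[OF Suc.prems(1) qx le \<eta>] B
          unfolding \<gamma>_def by (intro add_mono mult_left_mono) auto
        also have "(4 / Y'\<^sup>2) * (\<gamma>\<^sup>2 * (x \<bullet> v - Y)\<^sup>2 + 3 * \<eta>\<^sup>2 * S x) =
            4 * (x \<bullet> v - Y)\<^sup>2 / Y\<^sup>2 + (\<eta> * S x) * (12 * \<eta> / Y'\<^sup>2)"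
          unfolding Y'(2) by (rule split) (use \<gamma> Suc.prems(3) in auto)
        \<comment> \<open>The noise relative to \<open>Y'\<^sup>2\<close> costs at most
          \<open>B * (\<eta> * S x)\<close>, exactly the amount by which the energy term
          decreases.\<close>
        also have "(\<eta> * S x) * (12 * \<eta> / Y'\<^sup>2) \<le> (\<eta> * S x) * B"
        proof (rule mult_left_mono)
          show "12 * \<eta> / Y'\<^sup>2 \<le> B" using B' Y'(1) by (simp add: divide_le_eq)
          show "0 \<le> \<eta> * S x" using \<eta> S_nonneg[of x] by simp
        qed
        also have "\<delta> + (4 * (x \<bullet> v - Y)\<^sup>2 / Y\<^sup>2 + (\<eta> * S x) * B) + B * (q x - \<eta> * S x) =
            7 / 8 + 4 * (x \<bullet> v - Y)\<^sup>2 / Y\<^sup>2 + B * q x"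
          by (simp add: \<delta>_def right_diff_distrib)
        finally show ?thesis by simp
      qed
    qed
  qed
qed

end

subsection \<open>The tester\<close>

text \<open>Here \<open>a\<close> is the first observed value \<open>g \<bullet> A x\<close>.  With constant probability \<open>\<bar>a\<bar>\<close> is between \<open>l / 4\<close>
  and \<open>16 t\<close>, so that one of the first \<open>O(log (t / l))\<close> rates \<open>\<eta>\<close> satisfies
  \<open>1/24576 \<le> \<eta> t \<le> 1/12288\<close>, although the scale \<open>t\<close> is unknown.\<close>

definition rate :: "real \<Rightarrow> nat \<Rightarrow> real" where
  "rate a j = 1 / (768 * \<bar>a\<bar> * 2 ^ j)"

text \<open>All rates share the directions \<open>gs\<close>. No union bound arises: passing
  requires survival at every rate, so the one suitable rate, fixed by \<open>x\<close> and
  \<open>g\<close>, already bounds the probability.\<close>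

fun trial_passes :: "real mat \<Rightarrow> nat \<Rightarrow> real vec list \<Rightarrow> bool" where
  "trial_passes A J (x # g # gs) \<longleftrightarrow>
     passes A x g \<and> (\<forall>j<J. survives A (rate (g \<bullet> (A *\<^sub>v x)) j) x gs)"
| "trial_passes A J _ \<longleftrightarrow> True"

lemma avg_le_split:
  assumes "\<And>g. g \<in> carrier_vec d \<Longrightarrow> F g \<le> 1" "\<And>g. g \<in> carrier_vec d \<Longrightarrow> P g \<Longrightarrow> F g \<le> \<theta>"
    and "avg d (\<lambda>g. of_bool (P g)) \<ge> c" "\<theta> \<le> 1"
  shows "avg d F \<le> 1 - (1 - \<theta>) * c"
proof -
  have "avg d F \<le> avg d (\<lambda>g. 1 - (1 - \<theta>) * of_bool (P g))"
    by (rule avg_mono) (use assms(1,2) in auto)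
  also have "\<dots> = 1 - (1 - \<theta>) * avg d (\<lambda>g. of_bool (P g))"
    by (simp only: avg_diff avg_cmult avg_const)
  also have "\<dots> \<le> 1 - (1 - \<theta>) * c"
    using assms(3,4) by (intro diff_left_mono mult_left_mono) auto
  finally show ?thesis .
qed

lemma ex_dyadic_scale:
  fixes r :: real
  assumes "1 \<le> r" "r \<le> 2 ^ J"
  obtains j where "j \<le> J" "1 / 2 \<le> r / 2 ^ j" "r / 2 ^ j \<le> 1"
proof -
  define j where "j = (LEAST j. r \<le> 2 ^ j)"
  have j: "r \<le> 2 ^ j" unfolding j_def by (rule LeastI) (rule assms)
  have le: "j \<le> J" unfolding j_def by (rule Least_le) (rule assms)
  have "2 ^ j \<le> 2 * r"
  proof (cases j)
    case (Suc i)
    then have "\<not> r \<le> 2 ^ i" using not_less_Least[of i "\<lambda>j. r \<le> 2 ^ j"] by (simp add: j_def)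
    then show ?thesis using Suc by simp
  qed (use assms in simp)
  then show thesis using that[of j] j le by (simp add: field_simps)
qed

context indefinite_form
begin

text \<open>Three nested events: with probability at least 1/8 the start \<open>x\<close> has
  squared component at least 1/4 along \<open>v\<close>; given this, with probability at least 1/8
  the calibrating \<open>g\<close> sees \<open>A *\<^sub>v x\<close>; then a suitable rate is
  survived with probability at most 15/16. The product 1/8 * 1/8 * 1/16 is 1/1024.\<close>

lemma trial_passes_le:
  assumes X: "t \<le> X * l" and J: "64 * X \<le> 2 ^ J"
    and n: "1 \<le> 12 * (1 / (24576 * X))\<^sup>2 * (1 + 1 / (24576 * X)) ^ (2 * n)"
  shows "avgs d (Suc (Suc (Suc n))) (\<lambda>xs. of_bool (trial_passes A (Suc J) xs)) \<le> 1023 / 1024"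
proof -
  have X0: "X > 0" using X l t by (smt (verit) mult_nonpos_nonneg)
  define F where "F x g = avgs d (Suc n) (\<lambda>gs. of_bool (trial_passes A (Suc J) (x # g # gs)))" for x g
  have F1: "F x g \<le> 1" for x g
    using avgs_mono[of d "\<lambda>gs. of_bool (trial_passes A (Suc J) (x # g # gs))" "\<lambda>_. 1" "Suc n"]
    unfolding F_def by simp
  have F0: "F x g = 0" if "\<not> passes A x g" for x g
    using that unfolding F_def trial_passes.simps by simp
  have good: "F x g \<le> 15 / 16"
    if x: "x \<in> carrier_vec d" "(x \<bullet> v)\<^sup>2 \<ge> 1 / 4" "N x \<le> 16 * t"
      and g: "g \<in> carrier_vec d" "(g \<bullet> (A *\<^sub>v x))\<^sup>2 \<ge> S x / 4" "N g \<le> 16 * t" for x g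
  proof (cases "passes A x g")
    case True
    define a where "a = \<bar>g \<bullet> (A *\<^sub>v x)\<bar>"
    have q0: "q x \<ge> 0" using True by (simp add: passes_def q_def)
    have qx: "q x \<le> 16 * t" using q_le_N[OF x(1)] x(3) by simp
    have "a\<^sup>2 \<le> q x * q g" using True by (simp add: a_def passes_def q_def)
    also have "\<dots> \<le> q x * (16 * t)" using q_le_N[OF g(1)] g(3) q0 by (intro mult_left_mono) auto
    also have "\<dots> \<le> (16 * t) * (16 * t)" using qx t by (intro mult_right_mono) auto
    finally have "a\<^sup>2 \<le> (16 * t)\<^sup>2" by (simp add: power2_eq_square)
    then have a_le: "a \<le> 16 * t" by (rule power2_le_imp_le) (use t in auto)
    have "(l / 4)\<^sup>2 = l\<^sup>2 * (1 / 4) / 4" by (simp add: power_divide)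
    also have "\<dots> \<le> l\<^sup>2 * (x \<bullet> v)\<^sup>2 / 4" using x(2) by (intro divide_right_mono mult_left_mono) auto
    also have "\<dots> \<le> a\<^sup>2" using S_ge[OF x(1)] g(2) by (simp add: a_def)
    finally have a_ge: "l / 4 \<le> a" by (rule power2_le_imp_le) (simp add: a_def)
    then have a0: "a > 0" using l by linarith
    define r where "r = 16 * t / a"
    have r1: "1 \<le> r" using a_le a0 by (simp add: r_def)
    have "16 * t \<le> 64 * X * (l / 4)" using X by simp
    also have "\<dots> \<le> 64 * X * a" using a_ge X0 by (intro mult_left_mono) auto
    finally have "r \<le> 64 * X" using a0 by (simp add: r_def divide_le_eq)
    then have "r \<le> 2 ^ J" using J by simp
    from ex_dyadic_scale[OF r1 this] obtain j where j: "j \<le> J" "1 / 2 \<le> r / 2 ^ j" "r / 2 ^ j \<le> 1" .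
    define \<eta> where "\<eta> = rate (g \<bullet> (A *\<^sub>v x)) j"
    have \<eta>0: "\<eta> > 0" using a0 by (simp add: \<eta>_def rate_def a_def)
    \<comment> \<open>Here 12288 = 768 * 16, from \<open>rate\<close> and from \<open>r\<close>; the
      dyadic choice loses a factor of two, whence 24576.\<close>
    have \<eta>t: "\<eta> * t = (r / 2 ^ j) / 12288"
      using a0 by (simp add: \<eta>_def rate_def r_def a_def field_simps)
    have \<eta>t_le: "\<eta> * t \<le> 1 / 12288" unfolding \<eta>t by (rule divide_right_mono[OF j(3)]) simp
    \<comment> \<open>This start makes the initial tracking error zero; \<open>B\<close> below is
      the least value that \<open>survival_le_potential\<close> admits.\<close>
    define Y where "Y = x \<bullet> v"
    have Y2: "Y\<^sup>2 \<ge> 1 / 4" using x(2) by (simp add: Y_def)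
    then have Y: "Y \<noteq> 0" by auto
    define B where "B = 12 * \<eta> / Y\<^sup>2"
    have BY: "B * Y\<^sup>2 = 12 * \<eta>" using Y by (simp add: B_def)
    have B0: "B > 0" using \<eta>0 Y by (simp add: B_def)
    define c where "c = 1 / (24576 * X)"
    have c0: "c > 0" using X0 by (simp add: c_def)
    have c: "c \<le> \<eta> * l"
    proof -
      have "1 / 24576 \<le> \<eta> * t" using j(2) \<eta>t by simp
      also have "\<dots> \<le> \<eta> * (X * l)" using X \<eta>0 by (intro mult_left_mono) auto
      finally show ?thesis using X0 by (simp add: c_def field_simps)
    qed
    have "1 \<le> 12 * c\<^sup>2 * (1 + c) ^ (2 * n)" using n unfolding c_def .
    also have "\<dots> \<le> 12 * (\<eta> * l)\<^sup>2 * (1 + \<eta> * l) ^ (2 * n)"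
      using c c0 by (intro mult_mono power_mono) auto
    also have "12 * (\<eta> * l)\<^sup>2 = B * Y\<^sup>2 * \<eta> * l\<^sup>2"
      unfolding BY by (simp add: power2_eq_square)
    finally have cond: "1 \<le> B * \<eta> * l\<^sup>2 * Y\<^sup>2 * (1 + \<eta> * l) ^ (2 * n)"
      by (simp only: mult_ac)
    have "F x g \<le> survival d A \<eta> (Suc n) x"
      unfolding F_def survival_def using j(1) by (intro avgs_mono) (auto simp: \<eta>_def)
    also have "\<dots> \<le> 7 / 8 + 4 * (x \<bullet> v - Y)\<^sup>2 / Y\<^sup>2 + B * q x"
      by (rule survival_le_potential[OF x(1) q0 Y \<eta>0 _ B0 _ cond]) (use \<eta>t_le BY in auto)
    \<comment> \<open>The initial energy costs at most \<open>768 * \<eta> * t\<close>; keeping this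
      below 1/16 is what demands \<open>\<eta> * t \<le> 1 / 12288\<close>.\<close>
    also have "B * q x \<le> (48 * \<eta>) * (16 * t)"
    proof (rule mult_mono)
      have "48 * \<eta> * (1 / 4) \<le> 48 * \<eta> * Y\<^sup>2" using Y2 \<eta>0 by (intro mult_left_mono) auto
      then show "B \<le> 48 * \<eta>" using Y by (simp add: B_def divide_le_eq)
    qed (use qx q0 \<eta>0 in auto)
    also have "(48 * \<eta>) * (16 * t) \<le> 1 / 16" using \<eta>t_le by simp
    finally show ?thesis by (simp add: Y_def)
  qed (simp add: F0)
  have "avg d (F x) \<le> 127 / 128" if x: "x \<in> carrier_vec d" "(x \<bullet> v)\<^sup>2 \<ge> 1 / 4" "N x \<le> 16 * t" for x
  proof -
    have "l\<^sup>2 * (1 / 4) \<le> l\<^sup>2 * (x \<bullet> v)\<^sup>2" using x(2) by (intro mult_left_mono) auto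
    then have "S x > 0" using S_ge[OF x(1)] l by (smt (verit) mult_pos_pos zero_less_power zero_less_divide_1_iff)
    moreover have "A *\<^sub>v x \<in> carrier_vec d" using A x by simp
    ultimately have "avg d (\<lambda>g. of_bool ((g \<bullet> (A *\<^sub>v x))\<^sup>2 \<ge> S x / 4 \<and> N g \<le> 16 * t)) \<ge> 1 / 8"
      using avg_anticoncentration[OF _ _ t ws, of "A *\<^sub>v x"] unfolding S_def N_def by blast
    then have "avg d (F x) \<le> 1 - (1 - 15 / 16) * (1 / 8)"
      by (rule avg_le_split[OF F1, rotated]) (use good[OF x] in auto)
    then show ?thesis by simp
  qed
  moreover have "avg d (F x) \<le> 1" for x
    using avg_mono[of d "F x" "\<lambda>_. 1"] F1 by simp
  moreover have "avg d (\<lambda>x. of_bool ((x \<bullet> v)\<^sup>2 \<ge> 1 / 4 \<and> N x \<le> 16 * t)) \<ge> 1 / 8"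
    using avg_anticoncentration[OF v(1) _ t ws] unfolding v(2) N_def by simp
  ultimately have "avg d (\<lambda>x. avg d (F x)) \<le> 1 - (1 - 127 / 128) * (1 / 8)"
    by (intro avg_le_split[where P = "\<lambda>x. (x \<bullet> v)\<^sup>2 \<ge> 1 / 4 \<and> N x \<le> 16 * t"]) auto
  then show ?thesis unfolding avgs.simps(2)[of d "Suc (Suc n)"] avgs.simps(2)[of d "Suc n"] F_def by simp
qed

end

section \<open>One-sidedness\<close>

text \<open>Cauchy-Schwarz, from nonnegativity of the form on the span of \<open>x\<close> and
  \<open>g\<close>. If \<open>b = 0\<close>, the form at \<open>s = 1\<close> is affine in
  \<open>r\<close>, and \<open>r = (c + 1) / (2 * a)\<close> would make it -1 for nonzero
  \<open>a\<close>; otherwise \<open>s = b\<close> and \<open>r = a\<close> give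
  \<open>b * (b * c - a\<^sup>2)\<close>.\<close>

lemma psd_passes:
  assumes A: "A \<in> sym_mats d" "psd A" and x: "x \<in> carrier_vec d" and g: "g \<in> carrier_vec d"
  shows "passes A x g"
proof -
  have Ac: "A \<in> carrier_mat d d" "transpose_mat A = A" using A by (auto simp: sym_mats_def)
  have nn: "z \<bullet> (A *\<^sub>v z) \<ge> 0" if "z \<in> carrier_vec d" for z
    using A(2) that Ac by (auto simp: psd_def)
  define a b c where "a = g \<bullet> (A *\<^sub>v x)" and "b = g \<bullet> (A *\<^sub>v g)" and "c = x \<bullet> (A *\<^sub>v x)"
  have sym: "x \<bullet> (A *\<^sub>v g) = a" unfolding a_def by (rule symmetric_scalar_prod[OF Ac x g])
  have quad: "0 \<le> s\<^sup>2 * c - 2 * s * r * a + r\<^sup>2 * b" for s r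
  proof -
    have "0 \<le> (s \<cdot>\<^sub>v x - r \<cdot>\<^sub>v g) \<bullet> (A *\<^sub>v (s \<cdot>\<^sub>v x - r \<cdot>\<^sub>v g))"
      by (rule nn) (use x g in auto)
    also have "\<dots> = s\<^sup>2 * c - 2 * s * r * a + r\<^sup>2 * b"
      using Ac x g sym
      by (simp add: mult_minus_distrib_mat_vec[of _ d d] mult_mat_vec minus_scalar_prod_distrib[of _ d]
        scalar_prod_minus_distrib[of _ d] smult_scalar_prod_distrib[of _ d]
        scalar_prod_smult_distrib[of _ d] a_def[symmetric] b_def[symmetric] c_def[symmetric]
        power2_eq_square algebra_simps)
    finally show ?thesis .
  qed
  have "a\<^sup>2 \<le> c * b"
  proof (cases "b = 0")
    case True
    have "0 \<le> c - 2 * r * a" for r using quad[of 1 r] True by simp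
    from this[of "(c + 1) / (2 * a)"] have "a = 0" by (cases "a = 0") auto
    then show ?thesis using True by simp
  next
    case False
    then have "b > 0" using nn[OF g] by (simp add: b_def)
    moreover have "0 \<le> b * (b * c - a\<^sup>2)"
      using quad[of b a] by (simp add: power2_eq_square algebra_simps)
    ultimately show ?thesis by (simp add: zero_le_mult_iff mult.commute)
  qed
  then show ?thesis using nn[OF x] by (simp add: passes_def a_def b_def c_def)
qed

lemma psd_survives:
  assumes "A \<in> sym_mats d" "psd A" "x \<in> carrier_vec d" "set gs \<subseteq> carrier_vec d"
  shows "survives A \<eta> x gs"
  using assms(3,4) by (induction gs arbitrary: x) (auto intro: psd_passes[OF assms(1,2)] step_carrier)

lemma psd_trial_passes:
  assumes "A \<in> sym_mats d" "psd A" "set xs \<subseteq> carrier_vec d"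
  shows "trial_passes A J xs"
  using assms(3) by (cases "(A, J, xs)" rule: trial_passes.cases)
    (auto intro: psd_passes[OF assms(1,2)] psd_survives[OF assms(1,2)])

section \<open>The tester as an adaptive decision tree\<close>

text \<open>Continuation style: \<open>k\<close> is the tree entered when every test passes, so
  trials compose sequentially. The next point is computed from the answer \<open>a\<close> alone,
  without access to the matrix.\<close>

primrec descent :: "real \<Rightarrow> real vec \<Rightarrow> real vec list \<Rightarrow> vmv_alg \<Rightarrow> vmv_alg" where
  "descent \<eta> x [] k = k"
| "descent \<eta> x (g # gs) k = Query x x (\<lambda>q. Query g x (\<lambda>a. Query g g (\<lambda>b.
     if q \<ge> 0 \<and> a\<^sup>2 \<le> q * b then descent \<eta> (x - (\<eta> * a) \<cdot>\<^sub>v g) gs k else Output False)))"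

primrec descents :: "real \<Rightarrow> real vec \<Rightarrow> real vec list \<Rightarrow> nat \<Rightarrow> vmv_alg \<Rightarrow> vmv_alg" where
  "descents a x gs 0 k = k"
| "descents a x gs (Suc J) k = descent (rate a J) x gs (descents a x gs J k)"

fun trial :: "nat \<Rightarrow> real vec list \<Rightarrow> vmv_alg \<Rightarrow> vmv_alg" where
  "trial J (x # g # gs) k = Query x x (\<lambda>q. Query g x (\<lambda>a. Query g g (\<lambda>b.
     if q \<ge> 0 \<and> a\<^sup>2 \<le> q * b then descents a x gs J k else Output False)))"
| "trial J _ k = k"

primrec tester :: "nat \<Rightarrow> real vec list list \<Rightarrow> vmv_alg" where
  "tester J [] = Output True"
| "tester J (xs # xss) = trial J xs (tester J xss)"

lemma run_descent: "run A (descent \<eta> x gs k) \<longleftrightarrow> survives A \<eta> x gs \<and> run A k"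
  by (induction gs arbitrary: x) (auto simp: passes_def step_def)

lemma run_descents: "run A (descents a x gs J k) \<longleftrightarrow> (\<forall>j<J. survives A (rate a j) x gs) \<and> run A k"
  by (induction J) (auto simp: run_descent less_Suc_eq)

lemma run_trial: "run A (trial J xs k) \<longleftrightarrow> trial_passes A J xs \<and> run A k"
  by (cases "(J, xs, k)" rule: trial.cases) (auto simp: run_descents passes_def)

lemma run_tester: "run A (tester J xss) \<longleftrightarrow> (\<forall>xs\<in>set xss. trial_passes A J xs)"
  by (induction xss) (simp_all add: run_trial)

lemma num_queries_descent: "num_queries A (descent \<eta> x gs k) \<le> 3 * length gs + num_queries A k"
  by (induction gs arbitrary: x) (auto intro: order_trans)

lemma num_queries_descents: "num_queries A (descents a x gs J k) \<le> J * (3 * length gs) + num_queries A k"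
proof (induction J)
  case (Suc J)
  then show ?case
    using num_queries_descent[of A "rate a J" x gs "descents a x gs J k"] by simp
qed simp

lemma num_queries_trial: "num_queries A (trial J xs k) \<le> 3 + J * (3 * (length xs - 2)) + num_queries A k"
proof (cases "(J, xs, k)" rule: trial.cases)
  case (1 J x g gs k)
  then show ?thesis
    using num_queries_descents[of A "g \<bullet> (A *\<^sub>v x)" x gs J k] by simp
qed auto

lemma num_queries_tester:
  assumes "\<And>xs. xs \<in> set xss \<Longrightarrow> length xs = n + 2"
  shows "num_queries A (tester J xss) \<le> length xss * (3 + J * (3 * n))"
  using assms
proof (induction xss)
  case (Cons xs xss)
  have "num_queries A (tester J xss) \<le> length xss * (3 + J * (3 * n))"
    by (rule Cons.IH) (use Cons.prems in auto)
  then show ?case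
    using num_queries_trial[of A J xs "tester J xss"] Cons.prems[of xs] by simp
qed simp

lemma queries_in_dim_descent:
  assumes "queries_in_dim d k" "x \<in> carrier_vec d" "set gs \<subseteq> carrier_vec d"
  shows "queries_in_dim d (descent \<eta> x gs k)"
  using assms by (induction gs arbitrary: x) auto

lemma queries_in_dim_descents:
  assumes "queries_in_dim d k" "x \<in> carrier_vec d" "set gs \<subseteq> carrier_vec d"
  shows "queries_in_dim d (descents a x gs J k)"
  using assms by (induction J) (auto intro: queries_in_dim_descent)

lemma queries_in_dim_trial:
  assumes "queries_in_dim d k" "set xs \<subseteq> carrier_vec d"
  shows "queries_in_dim d (trial J xs k)"
  using assms by (cases "(J, xs, k)" rule: trial.cases) (auto intro: queries_in_dim_descents)

lemma queries_in_dim_tester: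
  assumes "\<And>xs. xs \<in> set xss \<Longrightarrow> set xs \<subseteq> carrier_vec d"
  shows "queries_in_dim d (tester J xss)"
  using assms by (induction xss) (auto intro!: queries_in_dim_trial)

section \<open>Measurability of the output in the matrix entries\<close>

abbreviation entries :: "nat \<Rightarrow> (nat \<times> nat \<Rightarrow> real) measure" where
  "entries d \<equiv> \<Pi>\<^sub>M ij \<in> {..<d} \<times> {..<d}. borel"

definition vec_measurable :: "nat \<Rightarrow> ((nat \<times> nat \<Rightarrow> real) \<Rightarrow> real vec) \<Rightarrow> bool" where
  "vec_measurable d X \<longleftrightarrow>
     (\<forall>a. X a \<in> carrier_vec d) \<and> (\<forall>i<d. (\<lambda>a. X a $ i) \<in> borel_measurable (entries d))"

lemma vec_measurable_const: "x \<in> carrier_vec d \<Longrightarrow> vec_measurable d (\<lambda>_. x)"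
  by (simp add: vec_measurable_def)

lemma borel_measurable_form:
  assumes "vec_measurable d X" "vec_measurable d Z"
  shows "(\<lambda>a. X a \<bullet> (mat d d a *\<^sub>v Z a)) \<in> borel_measurable (entries d)"
proof -
  have "X a \<bullet> (mat d d a *\<^sub>v Z a) = (\<Sum>i<d. X a $ i * (\<Sum>j<d. a (i, j) * Z a $ j))" for a
  proof -
    have "dim_vec (X a) = d" "dim_vec (Z a) = d" using assms by (auto simp: vec_measurable_def)
    then show ?thesis by (simp add: scalar_prod_def atLeast0LessThan)
  qed
  moreover have "(\<lambda>a. \<Sum>i<d. X a $ i * (\<Sum>j<d. a (i, j) * Z a $ j)) \<in> borel_measurable (entries d)"
    using assms unfolding vec_measurable_def
    by (intro borel_measurable_sum borel_measurable_times measurable_component_singleton) auto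
  ultimately show ?thesis by simp
qed

lemma pred_passes:
  assumes "vec_measurable d X" "g \<in> carrier_vec d"
  shows "Measurable.pred (entries d) (\<lambda>a. passes (mat d d a) (X a) g)"
proof -
  note G = vec_measurable_const[OF assms(2)]
  have "Measurable.pred (entries d) (\<lambda>a. f a \<ge> 0 \<and> (h a)\<^sup>2 \<le> f a * k a)"
    if "f \<in> borel_measurable (entries d)" "h \<in> borel_measurable (entries d)"
      "k \<in> borel_measurable (entries d)" for f h k :: "(nat \<times> nat \<Rightarrow> real) \<Rightarrow> real"
  proof (rule pred_intros_logic)
    show "Measurable.pred (entries d) (\<lambda>a. f a \<ge> 0)"
      unfolding pred_def by (intro borel_measurable_le borel_measurable_const that)
    show "Measurable.pred (entries d) (\<lambda>a. (h a)\<^sup>2 \<le> f a * k a)"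
      unfolding pred_def by (intro borel_measurable_le borel_measurable_power borel_measurable_times that)
  qed
  from this[OF borel_measurable_form[OF assms(1) assms(1)] borel_measurable_form[OF G assms(1)]
      borel_measurable_form[OF G G]]
  show ?thesis unfolding passes_def .
qed

lemma vec_measurable_step:
  assumes X: "vec_measurable d X" and g: "g \<in> carrier_vec d" and \<eta>: "\<eta> \<in> borel_measurable (entries d)"
  shows "vec_measurable d (\<lambda>a. step (mat d d a) (\<eta> a) (X a) g)"
proof -
  note [measurable] = \<eta> borel_measurable_form[OF vec_measurable_const[OF g] X]
  have "(\<lambda>a. step (mat d d a) (\<eta> a) (X a) g $ i) \<in> borel_measurable (entries d)" if i: "i < d" for i
  proof -
    have [measurable]: "(\<lambda>a. X a $ i) \<in> borel_measurable (entries d)"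
      using X i by (simp add: vec_measurable_def)
    have "step (mat d d a) (\<eta> a) (X a) g $ i = X a $ i - (\<eta> a * (g \<bullet> (mat d d a *\<^sub>v X a))) * g $ i" for a
      using X g i by (simp add: step_def vec_measurable_def carrier_vecD)
    then show ?thesis by simp
  qed
  moreover have "step (mat d d a) (\<eta> a) (X a) g \<in> carrier_vec d" for a
    using X g by (intro step_carrier) (auto simp: vec_measurable_def)
  ultimately show ?thesis by (simp add: vec_measurable_def)
qed

lemma pred_survives:
  assumes "vec_measurable d X" "set gs \<subseteq> carrier_vec d" "\<eta> \<in> borel_measurable (entries d)"
  shows "Measurable.pred (entries d) (\<lambda>a. survives (mat d d a) (\<eta> a) (X a) gs)"
  using assms(1,2)
proof (induction gs arbitrary: X)
  case (Cons g gs)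
  have g: "g \<in> carrier_vec d" "set gs \<subseteq> carrier_vec d" using Cons.prems by auto
  note [measurable] = pred_passes[OF Cons.prems(1) g(1)]
    Cons.IH[OF vec_measurable_step[OF Cons.prems(1) g(1) assms(3)] g(2)]
  show ?case unfolding survives.simps by measurable
qed simp

lemma pred_trial_passes:
  assumes "set xs \<subseteq> carrier_vec d"
  shows "Measurable.pred (entries d) (\<lambda>a. trial_passes (mat d d a) J xs)"
proof (cases "(undefined :: real mat, J, xs)" rule: trial_passes.cases)
  case (1 _ J' x g gs)
  then have c: "x \<in> carrier_vec d" "g \<in> carrier_vec d" "set gs \<subseteq> carrier_vec d" using assms by auto
  note X = vec_measurable_const[OF c(1)] and G = vec_measurable_const[OF c(2)]
  note [measurable] = borel_measurable_form[OF G X] pred_passes[OF X c(2)]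
  have [measurable]: "Measurable.pred (entries d)
      (\<lambda>a. survives (mat d d a) (rate (g \<bullet> (mat d d a *\<^sub>v x)) j) x gs)" for j
    by (rule pred_survives[OF X c(3)]) (simp add: rate_def)
  show ?thesis using 1 by simp
qed auto

lemma measurable_run_tester:
  assumes "\<And>xs. xs \<in> set xss \<Longrightarrow> set xs \<subseteq> carrier_vec d"
  shows "(\<lambda>a. run (mat d d a) (tester J xss)) \<in> measurable (entries d) (count_space UNIV)"
  unfolding run_tester using pred_trial_passes[OF assms] by (intro pred_intros_finite) auto

text \<open>A uniform choice from \<open>\<Omega>\<close> is encoded by constant functions to fit
  the sample space type. On a countable discrete coin space joint measurability reduces to
  measurability for each fixed coin.\<close>

lemma finite_coins:
  fixes T0 :: "'b \<Rightarrow> vmv_alg"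
  assumes \<Omega>: "finite \<Omega>" "\<Omega> \<noteq> {}"
    and dim: "\<And>c. c \<in> \<Omega> \<Longrightarrow> queries_in_dim d (T0 c)"
    and meas: "\<And>c. c \<in> \<Omega> \<Longrightarrow> (\<lambda>a. run (mat d d a) (T0 c)) \<in> measurable (entries d) (count_space UNIV)"
  obtains M :: "(nat \<Rightarrow> real) measure" and T where
    "rand_vmv_alg d M T" "\<And>\<omega>. \<omega> \<in> space M \<Longrightarrow> \<exists>c\<in>\<Omega>. T \<omega> = T0 c"
    "\<And>P. measure M {\<omega> \<in> space M. P (T \<omega>)} = real (card {c \<in> \<Omega>. P (T0 c)}) / real (card \<Omega>)"
proof -
  obtain f :: "'b \<Rightarrow> nat" where f: "inj_on f \<Omega>"
    using finite_imp_inj_to_nat_seg[OF \<Omega>(1)] by blast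
  define e :: "'b \<Rightarrow> nat \<Rightarrow> real" where "e c = (\<lambda>_. real (f c))" for c
  have e: "inj_on e \<Omega>" using f by (auto simp: inj_on_def e_def fun_eq_iff)
  define M where "M = uniform_count_measure (e ` \<Omega>)"
  define T where "T \<omega> = T0 (inv_into \<Omega> e \<omega>)" for \<omega>
  have Te: "T (e c) = T0 c" if "c \<in> \<Omega>" for c using e that by (simp add: T_def)
  have sp: "space M = e ` \<Omega>" by (simp add: M_def space_uniform_count_measure)
  have ps: "prob_space M" unfolding M_def by (rule prob_space_uniform_count_measure) (use \<Omega> in auto)
  have "(\<lambda>(\<omega>, a). run (mat d d a) (T \<omega>)) \<in>
      measurable (count_space (e ` \<Omega>) \<Otimes>\<^sub>M entries d) (count_space UNIV)"
    by (rule measurable_pair_measure_countable1) (use \<Omega> Te meas in \<open>auto simp: countable_finite\<close>)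
  moreover have "sets (M \<Otimes>\<^sub>M entries d) = sets (count_space (e ` \<Omega>) \<Otimes>\<^sub>M entries d)"
    by (rule sets_pair_measure_cong) (auto simp: M_def sets_uniform_count_measure)
  ultimately have m: "(\<lambda>(\<omega>, a). run (mat d d a) (T \<omega>)) \<in> measurable (M \<Otimes>\<^sub>M entries d) (count_space UNIV)"
    using measurable_cong_sets by blast
  show thesis
  proof (rule that)
    show "rand_vmv_alg d M T"
      unfolding rand_vmv_alg_def using ps m sp Te dim by auto
    show "\<exists>c\<in>\<Omega>. T \<omega> = T0 c" if "\<omega> \<in> space M" for \<omega>
      using that Te sp by auto
    show "measure M {\<omega> \<in> space M. P (T \<omega>)} = real (card {c \<in> \<Omega>. P (T0 c)}) / real (card \<Omega>)" for P
    proof -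
      have "{\<omega> \<in> space M. P (T \<omega>)} = e ` {c \<in> \<Omega>. P (T0 c)}" using sp Te by auto
      moreover have "card (e ` {c \<in> \<Omega>. P (T0 c)}) = card {c \<in> \<Omega>. P (T0 c)}"
        by (rule card_image) (rule inj_on_subset[OF e], auto)
      moreover have "card (e ` \<Omega>) = card \<Omega>" by (rule card_image[OF e])
      ultimately show ?thesis
        unfolding M_def using \<Omega> by (subst measure_uniform_count_measure) (auto simp: M_def)
    qed
  qed
qed

lemma avgs_eq_card:
  "avgs d n (\<lambda>xs. of_bool (P xs)) =
     real (card {xs. set xs \<subseteq> sign_vecs d \<and> length xs = n \<and> P xs}) /
     real (card {xs. set xs \<subseteq> sign_vecs d \<and> length xs = n})"
proof -
  let ?L = "\<lambda>n. {xs. set xs \<subseteq> sign_vecs d \<and> length xs = n}"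
  have fin: "finite (?L n)" for n by (rule finite_lists_length_eq) simp
  have card: "card (?L n) = (2 ^ d) ^ n" for n
    using card_lists_length_eq[of "sign_vecs d" n] by (simp add: card_sign_vecs)
  have "avgs d n F = (\<Sum>xs\<in>?L n. F xs) / (2 ^ d) ^ n" for F
  proof (induction n arbitrary: F)
    case 0
    have "?L 0 = {[]}" by auto
    then show ?case by simp
  next
    case (Suc n)
    have "(\<Sum>xs\<in>?L (Suc n). F xs) = (\<Sum>(xs, g)\<in>?L n \<times> sign_vecs d. F (g # xs))"
      unfolding lists_length_Suc_eq by (subst sum.reindex) (auto simp: inj_on_def case_prod_unfold)
    also have "\<dots> = (\<Sum>g\<in>sign_vecs d. \<Sum>xs\<in>?L n. F (g # xs))"
      by (subst sum.swap) (simp add: sum.cartesian_product)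
    finally show ?case
      by (simp add: Suc avg_def sum_divide_distrib[symmetric] mult.commute)
  qed
  also have "(\<Sum>xs\<in>?L n. of_bool (P xs)) = real (card {xs \<in> ?L n. P xs})"
    using fin[of n] by (simp add: of_bool_def sum.If_cases Int_def)
  finally show ?thesis by (simp add: card conj_assoc)
qed

section \<open>Choice of the parameters and the query bound\<close>

text \<open>Calibration gives a ratio \<open>16 * t / a\<close> of at most \<open>64 * x\<close>, so
  this many doublings reach the right rate.\<close>

definition scales :: "real \<Rightarrow> nat" where
  "scales x = nat \<lceil>log 2 (64 * x)\<rceil>"

text \<open>The number \<open>h = 24576 * x\<close> bounds \<open>1 / (\<eta> * l)\<close>: about
  \<open>h\<close> steps double the negative component, and \<open>log 2 h\<close> doublings
  multiply it by \<open>h\<close>.\<close>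

definition steps :: "real \<Rightarrow> nat" where
  "steps x = nat \<lceil>24576 * x\<rceil> * nat \<lceil>log 2 (24576 * x)\<rceil>"

lemma le_two_power_ceiling_log:
  assumes "x > 0"
  shows "x \<le> 2 ^ nat \<lceil>log 2 x\<rceil>"
proof -
  have "x = 2 powr log 2 x" using assms by simp
  also have "\<dots> \<le> 2 powr real (nat \<lceil>log 2 x\<rceil>)" by (intro powr_mono) linarith+
  finally show ?thesis by (simp add: powr_realpow)
qed

text \<open>Bernoulli's inequality gives a doubling per \<open>nat \<lceil>h\<rceil>\<close> steps;
  the square of the total growth \<open>h\<close> cancels \<open>(1 / h)\<^sup>2\<close>.\<close>

lemma steps_suffice:
  assumes "x \<ge> 1"
  shows "1 \<le> 12 * (1 / (24576 * x))\<^sup>2 * (1 + 1 / (24576 * x)) ^ (2 * steps x)"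
proof -
  define h where "h = 24576 * x"
  have h: "h \<ge> 1" using assms by (simp add: h_def)
  have "2 \<le> 1 + real (nat \<lceil>h\<rceil>) * (1 / h)"
  proof -
    have "h \<le> real (nat \<lceil>h\<rceil>)" by linarith
    then show ?thesis using h by simp
  qed
  also have "\<dots> \<le> (1 + 1 / h) ^ nat \<lceil>h\<rceil>"
    by (rule Bernoulli_inequality) (use h in \<open>auto intro: order_trans[of _ 0]\<close>)
  finally have "2 ^ nat \<lceil>log 2 h\<rceil> \<le> ((1 + 1 / h) ^ nat \<lceil>h\<rceil>) ^ nat \<lceil>log 2 h\<rceil>"
    by (intro power_mono) auto
  then have "h \<le> (1 + 1 / h) ^ steps x"
    using le_two_power_ceiling_log[of h] h unfolding steps_def h_def[symmetric] power_mult by linarith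
  then have "h\<^sup>2 \<le> ((1 + 1 / h) ^ steps x)\<^sup>2" using h by (intro power_mono) auto
  then have "1 \<le> (1 / h)\<^sup>2 * ((1 + 1 / h) ^ steps x)\<^sup>2"
    using h by (simp add: power_divide le_divide_eq)
  also have "((1 + 1 / h) ^ steps x)\<^sup>2 = (1 + 1 / h) ^ (2 * steps x)"
    by (simp add: power_mult[symmetric] mult.commute)
  finally show ?thesis unfolding h_def by simp
qed

definition query_bound :: "nat \<Rightarrow> real \<Rightarrow> nat" where
  "query_bound m x = m * (3 + Suc (scales x) * (3 * Suc (steps x)))"

text \<open>Each ceiling exceeds its argument by at most one; the resulting explicit bound has order
  \<open>x * ln x ^ 2\<close>, within the claimed class.\<close>

lemma query_bound_bigo: "(\<lambda>x. real (query_bound m x)) \<in> O(\<lambda>x. x * ln x ^ 3)"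
proof -
  define f where "f x = real m * (3 + (log 2 (64 * x) + 2) * (3 * ((24576 * x + 1) * (log 2 (24576 * x) + 1) + 1)))"
    for x
  have "real (query_bound m x) \<le> f x" if x: "x \<ge> 1" for x
  proof -
    have "log 2 (64 * x) \<ge> 0" "log 2 (24576 * x) \<ge> 0" by (subst zero_le_log_cancel_iff; use x in simp)+
    note logs = this
    have r: "real (nat \<lceil>y\<rceil>) \<le> y + 1" if "y \<ge> 0" for y using that by linarith
    have "real (scales x) \<le> log 2 (64 * x) + 1" unfolding scales_def
      by (rule r) (use x in simp)
    moreover have "real (steps x) \<le> (24576 * x + 1) * (log 2 (24576 * x) + 1)"
      unfolding steps_def of_nat_mult
    proof (rule mult_mono)
      show "real (nat \<lceil>24576 * x\<rceil>) \<le> 24576 * x + 1" using x by (intro r) simp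
      show "real (nat \<lceil>log 2 (24576 * x)\<rceil>) \<le> log 2 (24576 * x) + 1" by (rule r[OF logs(2)])
      show "0 \<le> 24576 * x + 1" using x by simp
      show "0 \<le> real (nat \<lceil>log 2 (24576 * x)\<rceil>)" by (rule of_nat_0_le_iff)
    qed
    ultimately have "1 + real (scales x) \<le> log 2 (64 * x) + 2"
      "1 + real (steps x) \<le> (24576 * x + 1) * (log 2 (24576 * x) + 1) + 1" by linarith+
    then have "(1 + real (scales x)) * (3 * (1 + real (steps x))) \<le>
        (log 2 (64 * x) + 2) * (3 * ((24576 * x + 1) * (log 2 (24576 * x) + 1) + 1))"
      using logs by (intro mult_mono[OF _ mult_left_mono]) (simp_all del: zero_le_log_cancel_iff)
    then show ?thesis
      unfolding f_def query_bound_def of_nat_mult of_nat_add of_nat_Suc of_nat_numeral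
      by (intro mult_left_mono add_left_mono) simp_all
  qed
  then have "norm (real (query_bound m x)) \<le> 1 * norm (f x)" if "x \<ge> 1" for x
    using that by (metis abs_ge_self abs_of_nat mult_1 order_trans real_norm_def)
  then have "(\<lambda>x. real (query_bound m x)) \<in> O(f)"
    by (intro bigoI[of _ 1] eventually_mono[OF eventually_ge_at_top[of 1]])
  also have "f \<in> O(\<lambda>x. x * ln x ^ 3)"
    unfolding f_def log_def by real_asymp
  finally show ?thesis .
qed

theorem corollary3:
  shows "\<exists>N :: real \<Rightarrow> nat.
    (\<lambda>x. real (N x)) \<in> O(\<lambda>x. x * ln x ^ 3) \<and>
    (\<forall>(d :: nat) (p :: ereal) (\<epsilon> :: real). d \<ge> 1 \<longrightarrow> 1 \<le> p \<longrightarrow> 0 < \<epsilon> \<longrightarrow> \<epsilon> < 1 \<longrightarrow>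
      (\<exists>(M :: (nat \<Rightarrow> real) measure) (T :: (nat \<Rightarrow> real) \<Rightarrow> vmv_alg).
         psd_tester \<epsilon> p d M T \<and>
         one_sided d M T \<and>
         makes_at_most d M T (N (1 / \<epsilon> * real d powr (1 - real_of_ereal (1 / p))))))"
proof -
  \<comment> \<open>A trial accepts a far matrix with probability at most 1023/1024, so
    \<open>m\<close> independent trials, a number fixed before \<open>d\<close>, \<open>p\<close>
    and \<open>\<epsilon>\<close>, push the error below 1/3.\<close>
  obtain m :: nat where m: "(1023 / 1024 :: real) ^ m < 1 / 3"
    using real_arch_pow_inv[of "1 / 3" "1023 / 1024"] by auto
  have "\<exists>(M :: (nat \<Rightarrow> real) measure) T. psd_tester \<epsilon> p d M T \<and> one_sided d M T \<and>
      makes_at_most d M T (query_bound m (1 / \<epsilon> * real d powr (1 - real_of_ereal (1 / p))))"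
    if d: "d \<ge> 1" and p: "1 \<le> p" and \<epsilon>: "0 < \<epsilon>" "\<epsilon> < 1" for d :: nat and p :: ereal and \<epsilon> :: real
  proof -
    define x where "x = 1 / \<epsilon> * real d powr (1 - real_of_ereal (1 / p))"
    have x: "x \<ge> 1"
    proof -
      have "real_of_ereal (1 / p) \<le> 1"
        using p by (cases p) (auto simp: one_ereal_def divide_le_eq)
      then have "1 \<le> real d powr (1 - real_of_ereal (1 / p))"
        using d by (intro ge_one_powr_ge_zero) auto
      then show ?thesis using \<epsilon> mult_mono[of 1 "1 / \<epsilon>" 1] by (simp add: x_def)
    qed
    \<comment> \<open>A starting vector, a calibrating vector and \<open>Suc (steps x)\<close>
      directions.\<close>
    define n where "n = Suc (Suc (Suc (steps x)))"
    define J where "J = Suc (scales x)"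
    define L where "L = {xs. set xs \<subseteq> sign_vecs d \<and> length xs = n}"
    define \<Omega> where "\<Omega> = {xss. set xss \<subseteq> L \<and> length xss = m}"
    have sub: "set xs \<subseteq> carrier_vec d" if "xs \<in> L" for xs
      using that sign_vecs_carrier by (auto simp: L_def)
    have L: "finite L" "card L > 0"
      using finite_lists_length_eq[of "sign_vecs d" n] card_lists_length_eq[of "sign_vecs d" n]
      by (auto simp: L_def card_sign_vecs)
    have card\<Omega>: "card {xss. set xss \<subseteq> K \<and> length xss = m} = card K ^ m" if "K \<subseteq> L" for K
      using card_lists_length_eq finite_subset[OF that L(1)] by blast
    have "card \<Omega> > 0" using card\<Omega>[OF order_refl] L(2) unfolding \<Omega>_def by simp
    then have \<Omega>: "finite \<Omega>" "\<Omega> \<noteq> {}" "card \<Omega> > 0" by (auto simp: card_gt_0_iff)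
    obtain M :: "(nat \<Rightarrow> real) measure" and T where MT: "rand_vmv_alg d M T"
      "\<And>\<omega>. \<omega> \<in> space M \<Longrightarrow> \<exists>c\<in>\<Omega>. T \<omega> = tester J c"
      "\<And>P. measure M {\<omega> \<in> space M. P (T \<omega>)} = real (card {c \<in> \<Omega>. P (tester J c)}) / real (card \<Omega>)"
    proof (rule finite_coins[OF \<Omega>(1,2)])
      fix c assume "c \<in> \<Omega>"
      then have c: "set xs \<subseteq> carrier_vec d" if "xs \<in> set c" for xs using that sub by (auto simp: \<Omega>_def)
      show "queries_in_dim d (tester J c)" by (rule queries_in_dim_tester) (rule c)
      show "(\<lambda>a. run (mat d d a) (tester J c)) \<in> measurable (entries d) (count_space UNIV)"
        by (rule measurable_run_tester) (rule c)
    qed blast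
    have one: "one_sided d M T"
      unfolding one_sided_def
    proof (intro ballI impI)
      fix \<omega> A assume *: "\<omega> \<in> space M" "A \<in> sym_mats d" "psd A"
      obtain c where "c \<in> \<Omega>" "T \<omega> = tester J c" using MT(2)[OF *(1)] by blast
      then show "run A (T \<omega>)"
        using psd_trial_passes[OF *(2,3)] sub by (auto simp: run_tester \<Omega>_def)
    qed
    have most: "makes_at_most d M T (query_bound m x)"
      unfolding makes_at_most_def
    proof (intro ballI)
      fix \<omega> A assume *: "\<omega> \<in> space M"
      obtain c where c: "c \<in> \<Omega>" "T \<omega> = tester J c" using MT(2)[OF *] by blast
      then show "num_queries A (T \<omega>) \<le> query_bound m x"
        using num_queries_tester[of c "Suc (steps x)" A J]
        by (auto simp: \<Omega>_def L_def n_def J_def query_bound_def)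
    qed
    have "measure M {\<omega> \<in> space M. \<not> run A (T \<omega>)} \<ge> 2 / 3"
      if A: "A \<in> sym_mats d" and far: "far_from_psd \<epsilon> p A" for A
    proof -
      have Ac: "A \<in> carrier_mat d d" "transpose_mat A = A" using A by (auto simp: sym_mats_def)
      obtain v l ws t where w: "v \<in> carrier_vec d" "v \<bullet> v = 1" "A *\<^sub>v v = (- l) \<cdot>\<^sub>v v" "0 < t"
        "t \<le> x * l" "\<And>w. w \<in> set ws \<Longrightarrow> w \<in> carrier_vec d" "(\<Sum>w\<leftarrow>ws. w \<bullet> w) \<le> t"
        "\<And>g. g \<in> carrier_vec d \<Longrightarrow> g \<bullet> (A *\<^sub>v g) \<le> (\<Sum>w\<leftarrow>ws. (g \<bullet> w)\<^sup>2)"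
        by (rule far_from_psd_witness[OF A d p \<epsilon>(1) far, folded x_def]) (rule that)
      have "l > 0"
      proof (rule ccontr)
        assume "\<not> l > 0"
        then have "x * l \<le> 0" using x by (intro mult_nonneg_nonpos) auto
        then show False using w(4,5) by simp
      qed
      then interpret indefinite_form d A v ws l t
        by unfold_locales (use Ac w in auto)
      define K where "K = {xs \<in> L. trial_passes A J xs}"
      have "avgs d n (\<lambda>xs. of_bool (trial_passes A J xs)) \<le> 1023 / 1024"
        unfolding n_def J_def
      proof (rule trial_passes_le[OF w(5)])
        show "64 * x \<le> 2 ^ scales x"
          unfolding scales_def by (rule le_two_power_ceiling_log) (use x in simp)
      qed (rule steps_suffice[OF x])
      then have K: "real (card K) / real (card L) \<le> 1023 / 1024"
        unfolding avgs_eq_card K_def L_def by (simp add: conj_assoc)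
      \<comment> \<open>Independence of the trials: the accepting coins are the sequences over
        \<open>K\<close>, so the acceptance probability is an \<open>m\<close>-th power.\<close>
      have "{c \<in> \<Omega>. run A (tester J c)} = {xss. set xss \<subseteq> K \<and> length xss = m}"
        by (auto simp: \<Omega>_def K_def run_tester)
      then have "measure M {\<omega> \<in> space M. run A (T \<omega>)} = real (card K ^ m) / real (card L ^ m)"
        using MT(3)[of "run A"] card\<Omega>[of K] card\<Omega>[of L] by (simp add: \<Omega>_def K_def)
      also have "\<dots> = (real (card K) / real (card L)) ^ m" by (simp add: power_divide)
      also have "\<dots> \<le> (1023 / 1024) ^ m" by (rule power_mono[OF K]) simp
      finally have le: "measure M {\<omega> \<in> space M. run A (T \<omega>)} \<le> 1 / 3" using m by simp
      have "card {c \<in> \<Omega>. run A (tester J c)} + card {c \<in> \<Omega>. \<not> run A (tester J c)} = card \<Omega>"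
        using \<Omega>(1) by (subst card_Un_disjoint[symmetric]) (auto intro!: arg_cong[of _ _ card])
      then have "measure M {\<omega> \<in> space M. run A (T \<omega>)} + measure M {\<omega> \<in> space M. \<not> run A (T \<omega>)} = 1"
        using MT(3)[of "run A"] MT(3)[of "\<lambda>t. \<not> run A t"] \<Omega>(3)
        by (simp add: add_divide_distrib[symmetric] flip: of_nat_add)
      then show ?thesis using le by linarith
    qed
    moreover have "measure M {\<omega> \<in> space M. run A (T \<omega>)} \<ge> 2 / 3" if "A \<in> sym_mats d" "psd A" for A
    proof -
      have "{\<omega> \<in> space M. run A (T \<omega>)} = space M" using one that by (auto simp: one_sided_def)
      moreover have "prob_space M" using MT(1) by (simp add: rand_vmv_alg_def)
      ultimately show ?thesis by (simp add: prob_space.prob_space)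
    qed
    ultimately have "psd_tester \<epsilon> p d M T" using MT(1) by (simp add: psd_tester_def)
    then show ?thesis using one most unfolding x_def by blast
  qed
  then show ?thesis
    by (intro exI[of _ "query_bound m"]) (use query_bound_bigo in blast)
qed

end
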